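(* Let $\mathbb G$ be an infinite finitely generated group and let $\mu$ be a symmetric, non-degenerate probability measure on $\mathbb G$ generating a transient random walk $(X_n)$. If the Martin boundary of $(\mathbb G,\mu)$ is trivial (i.e. consists of a single point), then $$\lim_{r\to\infty}\ \sup_{|x|=r}\frac{d_G(e,x)}{r}=0, \qquad (1)$$ and for every path $\omega$ in the path space of the random walk along which the word-metric speed $\lim_{n\to\infty}|X_n(\omega)|/n$ exists and is finite, the Green speed $$l_G(\omega):=\lim_{n\to\infty}\frac{d_G(e,X_n(\omega))}{n}\qquad (2)$$ exists and equals $0$. Consequently, if the word speed is finite in probability, then $d_G(e,X_n)/n\to0$ in probability. In particular, if $(\mathbb G,\mu)$ is strong Liouville and $\mu$ is a symmetric, non-degenerate measure with superexponential moments generating a transient random walk, then (1) holds, and the Green speed (2) exists and equals $0$ along every path with existing finite word-metric speed.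
   Context: Non-degenerate: $\operatorname{supp}\mu$ generates $\mathbb G$ as a semigroup; symmetric: $\mu(g)=\mu(g^{-1})$. $|\cdot|$ is the word length for a fixed finite symmetric generating set. $X_n=S_1\cdots S_n$ with $S_i$ i.i.d. of law $\mu$. $G(x,y)=\sum_{n\ge0}\mu^{(n)}(x^{-1}y)$ is the Green function (finite by transience), with $\mu^{(n)}$ the $n$-fold convolution power, and the Green distance is $d_G(x,y):=\log G(e,e)-\log G(x,y)$. Martin kernel: $K(x,z)=G(x,z)/G(e,z)$. The Martin compactification $\widehat{\mathbb G}$ is the unique smallest compactification of $\mathbb G$ to which all functions $z\mapsto K(x,z)$, $x\in\mathbb G$, extend continuously; the Martin boundary is $\widehat{\mathbb G}\setminus\mathbb G$. The word speed is finite in probability if for every $\varepsilon>0$ there are $M>0$ and $N\in\mathbb N$ with $\mathbb P(|X_n|/n>M)<\varepsilon$ for all $n\ge N$. $\mu$ has superexponential moments if $\sum_{x}\mu(x)e^{\zeta|x|}<\infty$ for all $\zeta>0$. $f$ is $\mu$-harmonic if $f(k)=\sum_g\mu(g)f(kg)$ (absolutely convergent) for all $k$; $(\mathbb G,\mu)$ is strong Liouville if every positive $\mu$-harmonic function is constant. *)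

theory Defs
  imports "HOL-Probability.Probability" "HOL-Algebra.Group" "HOL-Algebra.Generated_Groups"
begin

section \<open>Word length\<close>

definition symmetric_generating_set :: "('a, 'b) monoid_scheme \<Rightarrow> 'a set \<Rightarrow> bool" where
  "symmetric_generating_set G T \<longleftrightarrow>
     finite T \<and> T \<subseteq> carrier G \<and> (\<forall>t\<in>T. inv\<^bsub>G\<^esub> t \<in> T) \<and> generate G T = carrier G"

definition word_length :: "('a, 'b) monoid_scheme \<Rightarrow> 'a set \<Rightarrow> 'a \<Rightarrow> nat" where
  "word_length G T x =
     (LEAST n. \<exists>ts. length ts = n \<and> set ts \<subseteq> T \<and> foldr (\<otimes>\<^bsub>G\<^esub>) ts \<one>\<^bsub>G\<^esub> = x)"

section \<open>Step distributions\<close>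

definition symmetric_law :: "('a, 'b) monoid_scheme \<Rightarrow> 'a pmf \<Rightarrow> bool" where
  "symmetric_law G \<mu> \<longleftrightarrow> (\<forall>g\<in>carrier G. pmf \<mu> g = pmf \<mu> (inv\<^bsub>G\<^esub> g))"

inductive_set semigroup_generated :: "('a, 'b) monoid_scheme \<Rightarrow> 'a set \<Rightarrow> 'a set"
  for G and A where
    base: "a \<in> A \<Longrightarrow> a \<in> semigroup_generated G A"
  | mult: "x \<in> semigroup_generated G A \<Longrightarrow> y \<in> semigroup_generated G A \<Longrightarrow>
           x \<otimes>\<^bsub>G\<^esub> y \<in> semigroup_generated G A"

definition nondegenerate :: "('a, 'b) monoid_scheme \<Rightarrow> 'a pmf \<Rightarrow> bool" where
  "nondegenerate G \<mu> \<longleftrightarrow> semigroup_generated G (set_pmf \<mu>) = carrier G"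

definition superexponential_moments :: "('a, 'b) monoid_scheme \<Rightarrow> 'a set \<Rightarrow> 'a pmf \<Rightarrow> bool" where
  "superexponential_moments G T \<mu> \<longleftrightarrow>
     (\<forall>\<zeta>::real. \<zeta> > 0 \<longrightarrow>
        (\<lambda>x. pmf \<mu> x * exp (\<zeta> * real (word_length G T x))) summable_on carrier G)"

definition harmonic :: "('a, 'b) monoid_scheme \<Rightarrow> 'a pmf \<Rightarrow> ('a \<Rightarrow> real) \<Rightarrow> bool" where
  "harmonic G \<mu> f \<longleftrightarrow>
     (\<forall>k\<in>carrier G.
        (\<lambda>g. \<bar>pmf \<mu> g * f (k \<otimes>\<^bsub>G\<^esub> g)\<bar>) summable_on carrier G \<and>
        f k = (\<Sum>\<^sub>\<infinity>g\<in>carrier G. pmf \<mu> g * f (k \<otimes>\<^bsub>G\<^esub> g)))"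

definition strong_Liouville :: "('a, 'b) monoid_scheme \<Rightarrow> 'a pmf \<Rightarrow> bool" where
  "strong_Liouville G \<mu> \<longleftrightarrow>
     (\<forall>f. harmonic G \<mu> f \<and> (\<forall>k\<in>carrier G. f k > 0) \<longrightarrow>
          (\<exists>c. \<forall>k\<in>carrier G. f k = c))"

section \<open>The random walk\<close>

text \<open>
  Points of the path space are recorded by their increments: \<open>\<omega> n\<close> is the increment
  $S_{n+1}$, and \<open>walk G \<omega> n\<close> is the position $X_n = S_1 \cdots S_n$.  Paths range over all
  sequences in the carrier, not only over those with increments in the support.
  Restricting the step law to the carrier (which contains its support) makes the events below
  measurable, whatever the monoid operation does outside the carrier.
\<close>

definition path_space :: "('a, 'b) monoid_scheme \<Rightarrow> 'a pmf \<Rightarrow> (nat \<Rightarrow> 'a) measure" where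
  "path_space G \<mu> = (\<Pi>\<^sub>M n\<in>UNIV. restrict_space (measure_pmf \<mu>) (carrier G))"

primrec walk :: "('a, 'b) monoid_scheme \<Rightarrow> (nat \<Rightarrow> 'a) \<Rightarrow> nat \<Rightarrow> 'a" where
  "walk G \<omega> 0 = \<one>\<^bsub>G\<^esub>"
| "walk G \<omega> (Suc n) = walk G \<omega> n \<otimes>\<^bsub>G\<^esub> \<omega> n"

definition path_prob :: "('a, 'b) monoid_scheme \<Rightarrow> 'a pmf \<Rightarrow> ((nat \<Rightarrow> 'a) \<Rightarrow> bool) \<Rightarrow> real" where
  "path_prob G \<mu> P = measure (path_space G \<mu>) {\<omega> \<in> space (path_space G \<mu>). P \<omega>}"

definition transient :: "('a, 'b) monoid_scheme \<Rightarrow> 'a pmf \<Rightarrow> bool" where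
  "transient G \<mu> \<longleftrightarrow> path_prob G \<mu> (\<lambda>\<omega>. \<exists>n\<ge>1. walk G \<omega> n = \<one>\<^bsub>G\<^esub>) < 1"

definition word_speed_finite_in_probability ::
    "('a, 'b) monoid_scheme \<Rightarrow> 'a set \<Rightarrow> 'a pmf \<Rightarrow> bool" where
  "word_speed_finite_in_probability G T \<mu> \<longleftrightarrow>
     (\<forall>\<epsilon>>0. \<exists>M::real. M > 0 \<and> (\<exists>N::nat. \<forall>n\<ge>N.
        path_prob G \<mu> (\<lambda>\<omega>. real (word_length G T (walk G \<omega> n)) / real n > M) < \<epsilon>))"

section \<open>Green function, Green distance and Martin kernel\<close>

definition convolution :: "('a, 'b) monoid_scheme \<Rightarrow> 'a pmf \<Rightarrow> 'a pmf \<Rightarrow> 'a pmf" where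
  "convolution G \<mu> \<nu> = map_pmf (\<lambda>(x, y). x \<otimes>\<^bsub>G\<^esub> y) (pair_pmf \<mu> \<nu>)"

primrec conv_power :: "('a, 'b) monoid_scheme \<Rightarrow> 'a pmf \<Rightarrow> nat \<Rightarrow> 'a pmf" where
  "conv_power G \<mu> 0 = return_pmf \<one>\<^bsub>G\<^esub>"
| "conv_power G \<mu> (Suc n) = convolution G (conv_power G \<mu> n) \<mu>"

definition green :: "('a, 'b) monoid_scheme \<Rightarrow> 'a pmf \<Rightarrow> 'a \<Rightarrow> 'a \<Rightarrow> real" where
  "green G \<mu> x y = (\<Sum>n. pmf (conv_power G \<mu> n) (inv\<^bsub>G\<^esub> x \<otimes>\<^bsub>G\<^esub> y))"

definition green_dist :: "('a, 'b) monoid_scheme \<Rightarrow> 'a pmf \<Rightarrow> 'a \<Rightarrow> 'a \<Rightarrow> real" where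
  "green_dist G \<mu> x y = ln (green G \<mu> \<one>\<^bsub>G\<^esub> \<one>\<^bsub>G\<^esub>) - ln (green G \<mu> x y)"

definition martin_kernel :: "('a, 'b) monoid_scheme \<Rightarrow> 'a pmf \<Rightarrow> 'a \<Rightarrow> 'a \<Rightarrow> real" where
  "martin_kernel G \<mu> x z = green G \<mu> x z / green G \<mu> \<one>\<^bsub>G\<^esub> z"

section \<open>The Martin compactification\<close>

definition compactification :: "'a set \<Rightarrow> 'c topology \<Rightarrow> ('a \<Rightarrow> 'c) \<Rightarrow> bool" where
  "compactification A C j \<longleftrightarrow>
     compact_space C \<and> Hausdorff_space C \<and>
     embedding_map (discrete_topology A) C j \<and> C closure_of (j ` A) = topspace C"

definition extends_continuously :: "'a set \<Rightarrow> 'c topology \<Rightarrow> ('a \<Rightarrow> 'c) \<Rightarrow> ('a \<Rightarrow> real) \<Rightarrow> bool" where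
  "extends_continuously A C j f \<longleftrightarrow>
     (\<exists>h. continuous_map C euclideanreal h \<and> (\<forall>z\<in>A. h (j z) = f z))"

definition kernel_compactification ::
    "('a, 'b) monoid_scheme \<Rightarrow> 'a pmf \<Rightarrow> 'c topology \<Rightarrow> ('a \<Rightarrow> 'c) \<Rightarrow> bool" where
  "kernel_compactification G \<mu> C j \<longleftrightarrow>
     compactification (carrier G) C j \<and>
     (\<forall>x\<in>carrier G. extends_continuously (carrier G) C j (martin_kernel G \<mu> x))"

text \<open>
  Smallest means that every other such compactification maps onto it over the group.  A definition
  cannot quantify over the types of the competing spaces, so they are taken on the type
  \<open>'a set set\<close>.  This is no restriction: a point of a Hausdorff compactification is determined by
  the trace of its neighbourhoods on the dense discrete space, so every compactification has a
  homeomorphic copy on this type (\<open>compactification_copy\<close>), and a Martin compactification lies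
  below the competing compactifications on all types (\<open>martin_compactification_least\<close>).
\<close>

definition martin_compactification ::
    "('a, 'b) monoid_scheme \<Rightarrow> 'a pmf \<Rightarrow> 'c topology \<Rightarrow> ('a \<Rightarrow> 'c) \<Rightarrow> bool" where
  "martin_compactification G \<mu> C j \<longleftrightarrow>
     kernel_compactification G \<mu> C j \<and>
     (\<forall>(D :: 'a set set topology) k. kernel_compactification G \<mu> D k \<longrightarrow>
        (\<exists>\<phi>. continuous_map D C \<phi> \<and> (\<forall>z\<in>carrier G. \<phi> (k z) = j z)))"

definition martin_boundary :: "('a, 'b) monoid_scheme \<Rightarrow> 'c topology \<Rightarrow> ('a \<Rightarrow> 'c) \<Rightarrow> 'c set" where
  "martin_boundary G C j = topspace C - j ` carrier G"

lemma compactification_subset: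
  assumes "compactification A C j"
  shows "j ` A \<subseteq> topspace C"
proof -
  have "homeomorphic_map (discrete_topology A) (subtopology C (j ` A)) j"
    using assms by (simp add: compactification_def embedding_map_def)
  then have "j ` A = topspace (subtopology C (j ` A))"
    by (metis homeomorphic_imp_surjective_map topspace_discrete_topology)
  then show ?thesis by (metis inf_le1 topspace_subtopology)
qed

lemma compactification_copy:
  fixes C :: "'c topology" and A :: "'a set"
  assumes C: "compactification A C j"
  shows "\<exists>(D :: 'a set set topology) \<psi>. homeomorphic_map C D \<psi> \<and> compactification A D (\<psi> \<circ> j)"
proof -
  define \<psi> where "\<psi> p = {j -` U \<inter> A | U. openin C U \<and> p \<in> U}" for p
  define D where "D = pullback_topology (\<psi> ` topspace C) (inv_into (topspace C) \<psi>) C"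
  note jA = compactification_subset[OF C]
  have inj: "inj_on \<psi> (topspace C)"
  proof (rule inj_onI, rule ccontr)
    fix p q assume p: "p \<in> topspace C" and q: "q \<in> topspace C" and eq: "\<psi> p = \<psi> q" and ne: "p \<noteq> q"
    have "Hausdorff_space C" using C by (simp add: compactification_def)
    then obtain U V where U: "openin C U" "p \<in> U" and V: "openin C V" "q \<in> V" and "disjnt U V"
      using p q ne unfolding Hausdorff_space_def by metis
    have "j -` V \<inter> A \<in> \<psi> q" unfolding \<psi>_def using V by blast
    then obtain W where W: "openin C W" "p \<in> W" "j -` V \<inter> A = j -` W \<inter> A"
      unfolding eq[symmetric] unfolding \<psi>_def by blast
    have "p \<in> C closure_of (j ` A)" using C p by (simp add: compactification_def)
    moreover have "openin C (W \<inter> U)" "p \<in> W \<inter> U" using U W by auto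
    ultimately obtain g where "g \<in> A" "j g \<in> W \<inter> U"
      unfolding in_closure_of by blast
    with W(3) \<open>disjnt U V\<close> show False by (auto simp: disjnt_def)
  qed
  have topD: "topspace D = \<psi> ` topspace C"
    unfolding D_def topspace_pullback_topology using inj by (auto simp: inv_into_into)
  have "homeomorphic_maps C D \<psi> (inv_into (topspace C) \<psi>)"
    unfolding homeomorphic_maps_def
  proof (intro conjI ballI)
    show "continuous_map C D \<psi>" unfolding D_def
    proof (rule continuous_map_pullback')
      show "continuous_map C C (inv_into (topspace C) \<psi> \<circ> \<psi>)"
        by (rule continuous_map_eq[OF continuous_map_id]) (simp add: inj)
    qed auto
    have "continuous_map D C (id \<circ> inv_into (topspace C) \<psi>)"
      unfolding D_def by (rule continuous_map_pullback) simp
    then show "continuous_map D C (inv_into (topspace C) \<psi>)" by simp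
  qed (auto simp: topD inj f_inv_into_f)
  then have hom: "homeomorphic_map C D \<psi>" unfolding homeomorphic_map_maps by blast
  then have "C homeomorphic_space D" by (rule homeomorphic_map_imp_homeomorphic_space)
  then have "compact_space D" "Hausdorff_space D"
    using C homeomorphic_compact_space homeomorphic_Hausdorff_space
    unfolding compactification_def by blast+
  moreover have "embedding_map (discrete_topology A) D (\<psi> \<circ> j)"
    using C hom unfolding compactification_def
    by (meson embedding_map_compose surjective_embedding_map)
  moreover have "D closure_of ((\<psi> \<circ> j) ` A) = topspace D"
    using homeomorphic_map_closure_of[OF hom jA] C topD
    by (simp add: compactification_def image_comp)
  ultimately show ?thesis using hom unfolding compactification_def by blast
qed

lemma martin_compactification_least:
  fixes C :: "'c topology" and E :: "'d topology"
  assumes C: "martin_compactification G \<mu> C j" and E: "kernel_compactification G \<mu> E k"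
  shows "\<exists>\<phi>. continuous_map E C \<phi> \<and> (\<forall>z\<in>carrier G. \<phi> (k z) = j z)"
proof -
  obtain D :: "'a set set topology" and \<psi> where hom: "homeomorphic_map E D \<psi>"
    and D: "compactification (carrier G) D (\<psi> \<circ> k)"
    using compactification_copy E unfolding kernel_compactification_def by blast
  obtain \<theta> where \<theta>: "homeomorphic_maps E D \<psi> \<theta>" using hom homeomorphic_map_maps by blast
  have kG: "k z \<in> topspace E" if "z \<in> carrier G" for z
    using E that compactification_subset unfolding kernel_compactification_def by blast
  have "extends_continuously (carrier G) D (\<psi> \<circ> k) f"
    if f: "extends_continuously (carrier G) E k f" for f
  proof -
    obtain h where "continuous_map E euclideanreal h" "\<forall>z\<in>carrier G. h (k z) = f z"
      using f unfolding extends_continuously_def by blast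
    then show ?thesis using \<theta> kG unfolding extends_continuously_def homeomorphic_maps_def
      by (intro exI[of _ "h \<circ> \<theta>"]) (auto intro: continuous_map_compose)
  qed
  then have "kernel_compactification G \<mu> D (\<psi> \<circ> k)"
    using D E unfolding kernel_compactification_def by blast
  then obtain \<phi> where "continuous_map D C \<phi>" "\<forall>z\<in>carrier G. \<phi> ((\<psi> \<circ> k) z) = j z"
    using C unfolding martin_compactification_def by blast
  then show ?thesis using \<theta> unfolding homeomorphic_maps_def
    by (intro exI[of _ "\<phi> \<circ> \<psi>"]) (auto intro: continuous_map_compose)
qed

end

theory Submission
  imports Defs "HOL-Complex_Analysis.Great_Picard"
begin

text \<open>
  Write $g(z) = G(e,z)$.  Everything rests on one statement: for every fixed $x$ the Martin kernel
  $K(x,z) = g(x^{-1}z)/g(z)$ tends to $1$ as $z$ leaves finite sets.  Granting it, fix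
  $\epsilon > 0$.  Outside a finite set $E$ multiplying $z$ by a generator changes $\log g(z)$ by
  less than $\epsilon$, so, walking back along a geodesic word until it ends at $e$ or meets $E$,
  one gets $|d_G(e,z)| \le B + \epsilon |z|$ with $B$ depending on $\epsilon$ only
  (\<open>green_dist_le\<close>).  On the sphere of radius $r$ this is $o(r)$; along a path it bounds
  $d_G(e,X_n)/n$ by $B/n + \epsilon |X_n|/n$, which gives the claims on the Green speed.

  Suppose first that the Martin boundary is one point.  A compactification that adds one point to
  a discrete space can only be its one-point compactification, so continuity of the extended
  kernels says that $K(x,z)$ has a limit $L(x)$ as $z \to \infty$.  The cocycle identity
  $K(xy,z) = K(x,z)\,K(y,x^{-1}z)$ makes $L$ a homomorphism into the positive reals.  If $x$ has
  finite order, then $L(x) = 1$.  If $x$ has infinite order, symmetry of $\mu$ enters: since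
  $g(z) = g(z^{-1})$, inversion turns left translation into right translation, so
  $g(zx)/g(z) \to L(x)$ as well and conjugation gives $g(x^{-1}zx)/g(z) \to L(x)^2$.  Along
  $z = x^n$ the left side is constantly $1$.  Hence $L = 1$ (\<open>kernel_limit_trivial\<close>).

  Suppose instead that positive harmonic functions are constant and that $\mu$ has superexponential
  moments.  Comparing neighbours gives the Harnack bound $K(x,z) \le c^{|x|}$, uniformly in $z$.  Therefore every
  sequence going to infinity has a subsequence along which the kernels converge pointwise, and the
  moment condition allows passing to the limit in the Poisson equation
  $K(x,z) = \sum_h \mu(h) K(xh,z)$, valid for $z \neq x$.  The limit is a positive harmonic
  function with value $1$ at $e$, hence it is $1$
  (\<open>kernel_tendsto_one_if_strong_Liouville\<close>).

  Transience enters through finiteness of the Green function: the renewal equation for returns to $e$ bounds the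
  partial sums of $\mu^{(n)}(e)$ by $1/(1-q)$, where $q < 1$ is the probability of returning
  (\<open>transient_summable\<close>).
\<close>

section \<open>Word length\<close>

locale generated_group = group G for G (structure) +
  fixes T :: "'a set"
  assumes gen: "symmetric_generating_set G T"
begin

abbreviation word :: "'a list \<Rightarrow> 'a" where
  "word ts \<equiv> foldr (\<otimes>) ts \<one>"

abbreviation len :: "'a \<Rightarrow> nat" where
  "len \<equiv> word_length G T"

lemma finite_T: "finite T" and T_carrier: "T \<subseteq> carrier G"
  and T_inv: "t \<in> T \<Longrightarrow> inv t \<in> T" and generate_T: "generate G T = carrier G"
  using gen by (auto simp: symmetric_generating_set_def)

lemma word_closed: "set ts \<subseteq> T \<Longrightarrow> word ts \<in> carrier G"
  using T_carrier by (induction ts) auto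

lemma word_append:
  "set us \<subseteq> T \<Longrightarrow> set vs \<subseteq> T \<Longrightarrow> word (us @ vs) = word us \<otimes> word vs"
proof (induction us)
  case (Cons t us)
  then show ?case using T_carrier by (simp add: m_assoc word_closed subset_eq)
qed (simp add: word_closed)

lemma word_exists:
  assumes "x \<in> carrier G"
  shows "\<exists>ts. set ts \<subseteq> T \<and> word ts = x"
proof -
  have "x \<in> generate G T" using assms generate_T by simp
  then show ?thesis
  proof induction
    case one
    show ?case by (intro exI[of _ "[]"]) simp
  next
    case (incl t)
    then show ?case using T_carrier by (intro exI[of _ "[t]"]) auto
  next
    case (inv t)
    then show ?case using T_carrier T_inv by (intro exI[of _ "[inv t]"]) auto
  next
    case (eng x y)
    then obtain us vs where "set us \<subseteq> T" "word us = x" "set vs \<subseteq> T" "word vs = y" by blast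
    then show ?case by (intro exI[of _ "us @ vs"]) (simp add: word_append del: foldr_append)
  qed
qed

lemma word_length_le: "set ts \<subseteq> T \<Longrightarrow> len (word ts) \<le> length ts"
  unfolding word_length_def by (rule Least_le) blast

lemma geodesic_word:
  assumes "x \<in> carrier G"
  obtains ts where "set ts \<subseteq> T" "word ts = x" "length ts = len x"
proof -
  have "\<exists>n ts. length ts = n \<and> set ts \<subseteq> T \<and> word ts = x" using word_exists[OF assms] by blast
  then have "\<exists>ts. length ts = len x \<and> set ts \<subseteq> T \<and> word ts = x"
    unfolding word_length_def by (rule LeastI_ex)
  then show thesis using that by blast
qed

lemma word_length_eq_0: "x \<in> carrier G \<Longrightarrow> len x = 0 \<Longrightarrow> x = \<one>"
  by (metis foldr.simps(1) geodesic_word id_apply length_0_conv)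

lemma word_length_mult:
  assumes "x \<in> carrier G" "y \<in> carrier G"
  shows "len (x \<otimes> y) \<le> len x + len y"
proof -
  obtain us vs where "set us \<subseteq> T" "word us = x" "length us = len x"
    "set vs \<subseteq> T" "word vs = y" "length vs = len y"
    using geodesic_word assms by metis
  then show ?thesis using word_length_le[of "us @ vs"] by (simp add: word_append del: foldr_append)
qed

text \<open>
  Removing the first letter of a geodesic word leaves a geodesic word; this is the induction step
  of every argument that runs along geodesics.
\<close>

lemma geodesic_step:
  assumes "x \<in> carrier G" "len x = Suc n"
  obtains t y where "t \<in> T" "y \<in> carrier G" "x = t \<otimes> y" "len y = n"
proof -
  obtain ts where ts: "set ts \<subseteq> T" "word ts = x" "length ts = len x"
    using geodesic_word assms(1) .
  with assms(2) obtain t us where eq: "ts = t # us" by (cases ts) auto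
  have "len (word us) \<le> n" using word_length_le[of us] ts eq assms(2) by simp
  moreover have "Suc n \<le> 1 + len (word us)"
  proof -
    have "len t \<le> 1" using word_length_le[of "[t]"] ts eq T_carrier by auto
    moreover have "len (t \<otimes> word us) \<le> len t + len (word us)"
      using ts eq T_carrier by (intro word_length_mult word_closed) auto
    ultimately show ?thesis using ts eq assms(2) by simp
  qed
  ultimately show thesis using ts eq word_closed[of us] by (intro that[of t "word us"]) simp_all
qed

lemma finite_ball: "finite {x \<in> carrier G. len x \<le> n}"
proof (rule finite_subset)
  show "{x \<in> carrier G. len x \<le> n} \<subseteq> word ` {ts. set ts \<subseteq> T \<and> length ts \<le> n}"
  proof
    fix x assume x: "x \<in> {x \<in> carrier G. len x \<le> n}"
    then have "x \<in> carrier G" by simp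
    then obtain ts where "set ts \<subseteq> T" "word ts = x" "length ts = len x"
      by (rule geodesic_word)
    with x show "x \<in> word ` {ts. set ts \<subseteq> T \<and> length ts \<le> n}"
      by (intro image_eqI[of _ _ ts]) simp_all
  qed
  show "finite (word ` {ts. set ts \<subseteq> T \<and> length ts \<le> n})"
    using finite_T by (intro finite_imageI finite_lists_length_le)
qed

lemma countable_carrier: "countable (carrier G)"
proof -
  have "countable (\<Union>n. {x \<in> carrier G. len x \<le> n})"
    by (intro countable_UN countableI_type countable_finite finite_ball)
  moreover have "carrier G = (\<Union>n. {x \<in> carrier G. len x \<le> n})" by auto
  ultimately show ?thesis by simp
qed

lemma sphere_nonempty:
  assumes "infinite (carrier G)"
  shows "{x \<in> carrier G. len x = n} \<noteq> {}"
proof -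
  have "\<not> carrier G \<subseteq> {x \<in> carrier G. len x \<le> n}"
    using assms finite_ball finite_subset by blast
  then obtain x where "x \<in> carrier G" "\<not> len x \<le> n" by blast
  then have x: "x \<in> carrier G" "n \<le> len x" by simp_all
  \<comment> \<open>Suffixes of a geodesic word are geodesic and have every smaller length.\<close>
  define k where "k = len x - n"
  have "len x = n + k" using x by (simp add: k_def)
  then show ?thesis using x(1)
  proof (induction k arbitrary: x)
    case (Suc k)
    have "len x = Suc (n + k)" using Suc.prems by simp
    with Suc.prems(2) obtain t y where "y \<in> carrier G" "len y = n + k" by (rule geodesic_step)
    then show ?case using Suc.IH by blast
  qed auto
qed

end

section \<open>Convolution powers\<close>

lemma convolution_bind:
  "convolution G P Q = bind_pmf P (\<lambda>x. map_pmf (\<lambda>y. x \<otimes>\<^bsub>G\<^esub> y) Q)"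
  by (simp add: convolution_def pair_pmf_def map_bind_pmf map_pmf_def bind_assoc_pmf bind_return_pmf)

lemma pmf_convolution_ge:
  "pmf P x * pmf Q y \<le> pmf (convolution G P Q) (x \<otimes>\<^bsub>G\<^esub> y)"
proof -
  have "pmf P x * pmf Q y = measure (pair_pmf P Q) {(x, y)}"
    by (simp add: measure_pmf_single pmf_pair)
  also have "\<dots> \<le> pmf (convolution G P Q) (x \<otimes>\<^bsub>G\<^esub> y)"
    unfolding convolution_def pmf_map by (rule measure_pmf.finite_measure_mono) auto
  finally show ?thesis .
qed

locale group_law = group G for G (structure) +
  fixes \<mu> :: "'a pmf"
  assumes supp: "set_pmf \<mu> \<subseteq> carrier G"
begin

abbreviation conv :: "nat \<Rightarrow> 'a pmf" where
  "conv \<equiv> conv_power G \<mu>"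

lemma convolution_assoc:
  assumes "set_pmf P \<subseteq> carrier G" "set_pmf Q \<subseteq> carrier G" "set_pmf R \<subseteq> carrier G"
  shows "convolution G (convolution G P Q) R = convolution G P (convolution G Q R)"
proof -
  have "convolution G (convolution G P Q) R =
      bind_pmf P (\<lambda>x. bind_pmf Q (\<lambda>y. map_pmf (\<lambda>z. (x \<otimes> y) \<otimes> z) R))"
    by (simp add: convolution_bind bind_assoc_pmf bind_map_pmf)
  also have "\<dots> = bind_pmf P (\<lambda>x. bind_pmf Q (\<lambda>y. map_pmf (\<lambda>z. x \<otimes> (y \<otimes> z)) R))"
    using assms by (intro bind_pmf_cong map_pmf_cong refl) (auto intro: m_assoc)
  also have "\<dots> = convolution G P (convolution G Q R)"
    by (simp add: convolution_bind map_bind_pmf map_pmf_comp)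
  finally show ?thesis .
qed

lemma set_convolution:
  "set_pmf P \<subseteq> carrier G \<Longrightarrow> set_pmf Q \<subseteq> carrier G \<Longrightarrow> set_pmf (convolution G P Q) \<subseteq> carrier G"
  by (auto simp: convolution_bind)

lemma set_conv: "set_pmf (conv n) \<subseteq> carrier G"
proof (induction n)
  case (Suc n)
  then show ?case using set_convolution[OF Suc supp] by simp
qed simp

lemma convolution_one:
  assumes "set_pmf P \<subseteq> carrier G"
  shows "convolution G P (return_pmf \<one>) = P"
proof -
  have "convolution G P (return_pmf \<one>) = map_pmf (\<lambda>x. x \<otimes> \<one>) P"
    by (simp add: convolution_bind map_pmf_def bind_return_pmf)
  also have "\<dots> = map_pmf (\<lambda>x. x) P" using assms by (intro map_pmf_cong refl) auto
  finally show ?thesis by simp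
qed

lemma convolution_one':
  assumes "set_pmf P \<subseteq> carrier G"
  shows "convolution G (return_pmf \<one>) P = P"
proof -
  have "convolution G (return_pmf \<one>) P = map_pmf (\<lambda>x. \<one> \<otimes> x) P"
    by (simp add: convolution_bind bind_return_pmf)
  also have "\<dots> = map_pmf (\<lambda>x. x) P" using assms by (intro map_pmf_cong refl) auto
  finally show ?thesis by simp
qed

lemma conv_add: "conv (m + n) = convolution G (conv m) (conv n)"
  by (induction n) (simp_all add: convolution_one set_conv convolution_assoc supp)

lemma conv_Suc_left: "conv (Suc n) = convolution G \<mu> (conv n)"
  using conv_add[of 1 n] by (simp add: convolution_one' supp)

lemma conv_add_ge: "pmf (conv m) x * pmf (conv n) y \<le> pmf (conv (m + n)) (x \<otimes> y)"
  unfolding conv_add by (rule pmf_convolution_ge)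

lemma pmf_map_left_translate:
  assumes "set_pmf P \<subseteq> carrier G" "x \<in> carrier G" "g \<in> carrier G"
  shows "pmf (map_pmf (\<lambda>y. g \<otimes> y) P) x = pmf P (inv g \<otimes> x)"
proof -
  have "pmf (map_pmf (\<lambda>y. g \<otimes> y) P) x = measure P ((\<lambda>y. g \<otimes> y) -` {x})" by (rule pmf_map)
  also have "\<dots> = measure P {inv g \<otimes> x}"
    using assms by (intro measure_pmf.finite_measure_eq_AE)
      (auto simp: AE_measure_pmf_iff m_assoc[symmetric] subset_eq)
  finally show ?thesis by (simp add: measure_pmf_single)
qed

lemma pmf_map_right_translate:
  assumes "set_pmf P \<subseteq> carrier G" "x \<in> carrier G" "g \<in> carrier G"
  shows "pmf (map_pmf (\<lambda>y. y \<otimes> g) P) x = pmf P (x \<otimes> inv g)"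
proof -
  have "pmf (map_pmf (\<lambda>y. y \<otimes> g) P) x = measure P ((\<lambda>y. y \<otimes> g) -` {x})" by (rule pmf_map)
  also have "\<dots> = measure P {x \<otimes> inv g}"
    using assms by (intro measure_pmf.finite_measure_eq_AE)
      (auto simp: AE_measure_pmf_iff m_assoc subset_eq)
  finally show ?thesis by (simp add: measure_pmf_single)
qed

lemma pmf_map_inv:
  assumes "set_pmf P \<subseteq> carrier G" "x \<in> carrier G"
  shows "pmf (map_pmf (\<lambda>y. inv y) P) x = pmf P (inv x)"
proof -
  have "pmf (map_pmf (\<lambda>y. inv y) P) x = measure P ((\<lambda>y. inv y) -` {x})" by (rule pmf_map)
  also have "\<dots> = measure P {inv x}"
    using assms by (intro measure_pmf.finite_measure_eq_AE) (auto simp: AE_measure_pmf_iff)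
  finally show ?thesis by (simp add: measure_pmf_single)
qed

lemma conv_positive_on_semigroup:
  "x \<in> semigroup_generated G (set_pmf \<mu>) \<Longrightarrow> \<exists>n. pmf (conv n) x > 0"
proof (induction rule: semigroup_generated.induct)
  case (base a)
  then have "pmf (conv (Suc 0)) a > 0"
    by (simp add: convolution_one' supp pmf_positive)
  then show ?case by blast
next
  case (mult x y)
  then obtain m n where "pmf (conv m) x > 0" "pmf (conv n) y > 0" by blast
  then have "0 < pmf (conv m) x * pmf (conv n) y" by simp
  then show ?case using conv_add_ge[of m x n y] by (intro exI[of _ "m + n"]) linarith
qed

lemma map_inv_convolution:
  assumes "set_pmf P \<subseteq> carrier G" "set_pmf Q \<subseteq> carrier G"
  shows "map_pmf (\<lambda>y. inv y) (convolution G P Q) =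
    convolution G (map_pmf (\<lambda>y. inv y) Q) (map_pmf (\<lambda>y. inv y) P)"
proof -
  have "map_pmf (\<lambda>y. inv y) (convolution G P Q) =
      bind_pmf P (\<lambda>x. bind_pmf Q (\<lambda>y. return_pmf (inv (x \<otimes> y))))"
    by (simp add: convolution_bind map_bind_pmf map_pmf_comp map_pmf_def bind_assoc_pmf bind_return_pmf)
  also have "\<dots> = bind_pmf P (\<lambda>x. bind_pmf Q (\<lambda>y. return_pmf (inv y \<otimes> inv x)))"
    using assms by (intro bind_pmf_cong refl arg_cong[where f = return_pmf]) (auto intro: inv_mult_group)
  also have "\<dots> = bind_pmf Q (\<lambda>y. bind_pmf P (\<lambda>x. return_pmf (inv y \<otimes> inv x)))"
    by (rule bind_commute_pmf)
  also have "\<dots> = convolution G (map_pmf (\<lambda>y. inv y) Q) (map_pmf (\<lambda>y. inv y) P)"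
    by (simp add: convolution_bind bind_map_pmf map_pmf_def bind_assoc_pmf bind_return_pmf)
  finally show ?thesis .
qed

text \<open>
  Inversion reverses the order of the factors in a convolution, and powers of one law commute.
\<close>

lemma conv_symmetric:
  assumes "symmetric_law G \<mu>" "x \<in> carrier G"
  shows "pmf (conv n) (inv x) = pmf (conv n) x"
proof -
  have sym: "map_pmf (\<lambda>y. inv y) \<mu> = \<mu>"
  proof (rule pmf_eqI)
    fix x
    show "pmf (map_pmf (\<lambda>y. inv y) \<mu>) x = pmf \<mu> x"
    proof (cases "x \<in> carrier G")
      case True
      then have "pmf \<mu> x = pmf \<mu> (inv x)" using assms(1) by (auto simp only: symmetric_law_def)
      then show ?thesis using pmf_map_inv[OF supp True] by simp
    next
      case False
      then have "x \<notin> set_pmf \<mu>" "x \<notin> set_pmf (map_pmf (\<lambda>y. inv y) \<mu>)" using supp by auto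
      then show ?thesis unfolding set_pmf_iff by simp
    qed
  qed
  have "map_pmf (\<lambda>y. inv y) (conv n) = conv n"
  proof (induction n)
    case (Suc n)
    have "map_pmf (\<lambda>y. inv y) (conv (Suc n)) = convolution G \<mu> (conv n)"
      by (simp add: map_inv_convolution set_conv supp Suc sym)
    also have "\<dots> = conv (Suc n)" by (rule conv_Suc_left[symmetric])
    finally show ?case .
  qed simp
  then show ?thesis by (metis assms(2) pmf_map_inv set_conv)
qed

end

section \<open>Path space and transience\<close>

lemma walk_cong: "(\<And>i. i < n \<Longrightarrow> \<omega> i = \<omega>' i) \<Longrightarrow> walk G \<omega> n = walk G \<omega>' n"
  by (induction n) auto

lemma walk_comb_seq_le: "m \<le> n \<Longrightarrow> walk G (comb_seq n \<omega> \<omega>') m = walk G \<omega> m"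
  by (rule walk_cong) (simp add: comb_seq_less)

locale group_walk = group_law +
  assumes countable: "countable (carrier G)"
begin

abbreviation step :: "'a measure" where
  "step \<equiv> restrict_space (measure_pmf \<mu>) (carrier G)"

abbreviation \<Omega> :: "(nat \<Rightarrow> 'a) measure" where
  "\<Omega> \<equiv> path_space G \<mu>"

lemma prob_space_step: "prob_space step"
proof (rule prob_space_restrict_space)
  show "emeasure (measure_pmf \<mu>) (carrier G) = 1"
    using supp by (simp add: measure_pmf.emeasure_eq_1_AE AE_measure_pmf_iff subset_eq)
qed simp

sublocale path: sequence_space step
  using prob_space_step by (intro sequence_space.intro product_prob_spaceI)

lemma path_space_eq: "\<Omega> = path.S"
  by (simp add: path_space_def)

sublocale \<Omega>: prob_space \<Omega>
  unfolding path_space_eq by (rule path.prob_space_axioms)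

lemma space_step: "space step = carrier G" and sets_step: "sets step = Pow (carrier G)"
  by (simp_all add: space_restrict_space sets_restrict_space image_def Pow_def) blast

lemma space_path: "\<omega> \<in> space \<Omega> \<longleftrightarrow> (\<forall>n. \<omega> n \<in> carrier G)"
  by (auto simp: path_space_eq space_PiM space_step PiE_iff)

lemma walk_closed: "\<omega> \<in> space \<Omega> \<Longrightarrow> walk G \<omega> n \<in> carrier G"
  by (induction n) (simp_all add: space_path)

lemma walk_comb_seq_add:
  assumes "\<omega> \<in> space \<Omega>" "\<omega>' \<in> space \<Omega>"
  shows "walk G (comb_seq m \<omega> \<omega>') (m + n) = walk G \<omega> m \<otimes> walk G \<omega>' n"
proof (induction n)
  case 0
  then show ?case using walk_comb_seq_le[of m m] walk_closed[OF assms(1)] by simp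
next
  case (Suc n)
  have "comb_seq m \<omega> \<omega>' (m + n) = \<omega>' n" using comb_seq_add[of m \<omega> \<omega>' n] by (simp add: add.commute)
  then show ?case using Suc walk_closed[OF assms(1)] walk_closed[OF assms(2)] assms(2)
    by (simp add: m_assoc space_path)
qed

lemma sets_coordinate: "A \<subseteq> carrier G \<Longrightarrow> {\<omega> \<in> space \<Omega>. \<omega> n \<in> A} \<in> sets \<Omega>"
proof -
  assume "A \<subseteq> carrier G"
  then have "A \<in> sets step" by (simp add: sets_step)
  moreover have "(\<lambda>\<omega>. \<omega> n) \<in> measurable \<Omega> step" unfolding path_space_eq by simp
  ultimately have "(\<lambda>\<omega>. \<omega> n) -` A \<inter> space \<Omega> \<in> sets \<Omega>" by (rule measurable_sets[rotated])
  then show ?thesis by (simp add: vimage_def Int_def conj_commute)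
qed

text \<open>
  On an uncountable discrete space multiplication need not be measurable for the product
  sigma-algebra; here the event is a countable union of rectangles.
\<close>

lemma sets_walk_eq: "{\<omega> \<in> space \<Omega>. walk G \<omega> n = x} \<in> sets \<Omega>"
proof (induction n arbitrary: x)
  case (Suc n)
  have "{\<omega> \<in> space \<Omega>. walk G \<omega> (Suc n) = x} =
      (\<Union>y\<in>carrier G. {\<omega> \<in> space \<Omega>. walk G \<omega> n = y} \<inter>
         {\<omega> \<in> space \<Omega>. \<omega> n \<in> {g \<in> carrier G. y \<otimes> g = x}})"
    by (auto simp: walk_closed) (simp add: space_path)
  also have "\<dots> \<in> sets \<Omega>"
    by (intro sets.countable_UN'' countable sets.Int Suc sets_coordinate) blast
  finally show ?case .
qed (cases "x = \<one>"; simp)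

lemma sets_walk: "{\<omega> \<in> space \<Omega>. P (walk G \<omega> n)} \<in> sets \<Omega>"
proof -
  have "{\<omega> \<in> space \<Omega>. P (walk G \<omega> n)} =
      (\<Union>y\<in>{y \<in> carrier G. P y}. {\<omega> \<in> space \<Omega>. walk G \<omega> n = y})"
    by (auto simp: walk_closed)
  also have "\<dots> \<in> sets \<Omega>"
    using countable sets_walk_eq by (intro sets.countable_UN'') auto
  finally show ?thesis .
qed

lemma emeasure_comb_seq:
  assumes "A \<in> sets \<Omega>"
  shows "emeasure \<Omega> A =
    emeasure (\<Omega> \<Otimes>\<^sub>M \<Omega>) {z \<in> space \<Omega> \<times> space \<Omega>. comb_seq n (fst z) (snd z) \<in> A}"
proof -
  have "emeasure \<Omega> A = emeasure (distr (\<Omega> \<Otimes>\<^sub>M \<Omega>) \<Omega> (\<lambda>(\<omega>, \<omega>'). comb_seq n \<omega> \<omega>')) A"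
    unfolding path_space_eq path.PiM_comb_seq ..
  also have "\<dots> = emeasure (\<Omega> \<Otimes>\<^sub>M \<Omega>)
      ((\<lambda>(\<omega>, \<omega>'). comb_seq n \<omega> \<omega>') -` A \<inter> space (\<Omega> \<Otimes>\<^sub>M \<Omega>))"
    using assms by (intro emeasure_distr) (simp_all add: path_space_eq measurable_comb_seq)
  also have "(\<lambda>(\<omega>, \<omega>'). comb_seq n \<omega> \<omega>') -` A \<inter> space (\<Omega> \<Otimes>\<^sub>M \<Omega>) =
      {z \<in> space \<Omega> \<times> space \<Omega>. comb_seq n (fst z) (snd z) \<in> A}"
    by (auto simp: space_pair_measure)
  finally show ?thesis .
qed

lemma comb_seq_space: "\<omega> \<in> space \<Omega> \<Longrightarrow> \<omega>' \<in> space \<Omega> \<Longrightarrow> comb_seq n \<omega> \<omega>' \<in> space \<Omega>"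
  by (auto simp: space_path comb_seq_def)

text \<open>
  Splicing two independent paths at time \<open>n\<close> makes the position at time \<open>n\<close> and the next increment
  independent, so conditioning on that increment reproduces the convolution.
\<close>

lemma walk_law:
  "x \<in> carrier G \<Longrightarrow> \<Omega>.prob {\<omega> \<in> space \<Omega>. walk G \<omega> n = x} = pmf (conv n) x"
proof (induction n arbitrary: x)
  case 0
  show ?case by (cases "x = \<one>") (auto simp: \<Omega>.prob_space)
next
  case (Suc n)
  let ?E = "\<lambda>n x. {\<omega> \<in> space \<Omega>. walk G \<omega> n = x}"
  let ?D = "{z \<in> space \<Omega> \<times> space \<Omega>. comb_seq n (fst z) (snd z) \<in> ?E (Suc n) x}"
  have D: "?D = {z \<in> space \<Omega> \<times> space \<Omega>. walk G (fst z) n \<otimes> snd z 0 = x}"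
  proof -
    have "walk G (comb_seq n \<omega> \<omega>') (Suc n) = walk G \<omega> n \<otimes> \<omega>' 0"
      if "\<omega> \<in> space \<Omega>" "\<omega>' \<in> space \<Omega>" for \<omega> \<omega>'
      using walk_comb_seq_add[OF that, of n 1] that by (simp add: space_path)
    then show ?thesis by (auto simp: comb_seq_space)
  qed
  have D_sets: "?D \<in> sets (\<Omega> \<Otimes>\<^sub>M \<Omega>)"
  proof -
    have "(\<lambda>(\<omega>, \<omega>'). comb_seq n \<omega> \<omega>') \<in> measurable (\<Omega> \<Otimes>\<^sub>M \<Omega>) \<Omega>"
      unfolding path_space_eq by (rule measurable_comb_seq)
    from measurable_sets[OF this sets_walk_eq[of "Suc n" x]] show ?thesis
      by (rule back_subst[where P = "\<lambda>A. A \<in> sets (\<Omega> \<Otimes>\<^sub>M \<Omega>)"])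
        (auto simp: space_pair_measure comb_seq_space)
  qed
  interpret pair_sigma_finite \<Omega> \<Omega> by unfold_locales
  have "emeasure \<Omega> (?E (Suc n) x) = emeasure (\<Omega> \<Otimes>\<^sub>M \<Omega>) ?D"
    by (rule emeasure_comb_seq[OF sets_walk_eq])
  also have "\<dots> = (\<integral>\<^sup>+\<omega>'. emeasure \<Omega> ((\<lambda>\<omega>. (\<omega>, \<omega>')) -` ?D) \<partial>\<Omega>)"
    by (rule emeasure_pair_measure_alt2[OF D_sets])
  also have "\<dots> = (\<integral>\<^sup>+\<omega>'. pmf (conv n) (x \<otimes> inv (\<omega>' 0)) \<partial>\<Omega>)"
  proof (rule nn_integral_cong)
    fix \<omega>' assume \<omega>': "\<omega>' \<in> space \<Omega>"
    have "(\<lambda>\<omega>. (\<omega>, \<omega>')) -` ?D = ?E n (x \<otimes> inv (\<omega>' 0))"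
    proof -
      have "walk G \<omega> n \<otimes> \<omega>' 0 = x \<longleftrightarrow> walk G \<omega> n = x \<otimes> inv (\<omega>' 0)" if "\<omega> \<in> space \<Omega>" for \<omega>
        using that \<omega>' Suc.prems by (metis inv_solve_right space_path walk_closed)
      then show ?thesis unfolding D using \<omega>' by auto
    qed
    moreover have "x \<otimes> inv (\<omega>' 0) \<in> carrier G" using \<omega>' Suc.prems by (simp add: space_path)
    ultimately show "emeasure \<Omega> ((\<lambda>\<omega>. (\<omega>, \<omega>')) -` ?D) = pmf (conv n) (x \<otimes> inv (\<omega>' 0))"
      using Suc.IH by (simp add: \<Omega>.emeasure_eq_measure)
  qed
  also have "\<dots> = (\<integral>\<^sup>+g. pmf (conv n) (x \<otimes> inv g) \<partial>distr \<Omega> step (\<lambda>\<omega>. \<omega> 0))"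
    by (subst nn_integral_distr) (simp_all add: path_space_eq measurable_restrict_space1)
  also have "distr \<Omega> step (\<lambda>\<omega>. \<omega> 0) = step"
    unfolding path_space_eq by (rule path.PiM_component) simp
  also have "(\<integral>\<^sup>+g. pmf (conv n) (x \<otimes> inv g) \<partial>step) =
      (\<integral>\<^sup>+g. ennreal (pmf (conv n) (x \<otimes> inv g)) * indicator (carrier G) g \<partial>measure_pmf \<mu>)"
    by (rule nn_integral_restrict_space) simp
  also have "\<dots> = (\<integral>\<^sup>+g. pmf (map_pmf (\<lambda>y. y \<otimes> g) (conv n)) x \<partial>measure_pmf \<mu>)"
    using supp Suc.prems
    by (intro nn_integral_cong_AE)
      (auto simp: AE_measure_pmf_iff pmf_map_right_translate[OF set_conv] subsetD)
  also have "\<dots> = pmf (bind_pmf \<mu> (\<lambda>g. map_pmf (\<lambda>y. y \<otimes> g) (conv n))) x"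
    by (rule ennreal_pmf_bind[symmetric])
  also have "bind_pmf \<mu> (\<lambda>g. map_pmf (\<lambda>y. y \<otimes> g) (conv n)) = conv (Suc n)"
    unfolding conv_power.simps convolution_bind map_pmf_def by (rule bind_commute_pmf)
  finally show ?case by (simp add: \<Omega>.emeasure_eq_measure)
qed

definition first_return :: "nat \<Rightarrow> (nat \<Rightarrow> 'a) set" where
  "first_return n =
     {\<omega> \<in> space \<Omega>. 1 \<le> n \<and> walk G \<omega> n = \<one> \<and> (\<forall>k. 1 \<le> k \<and> k < n \<longrightarrow> walk G \<omega> k \<noteq> \<one>)}"

lemma sets_first_return: "first_return n \<in> sets \<Omega>"
proof -
  have "{\<omega> \<in> space \<Omega>. \<forall>k\<in>{1..<n}. walk G \<omega> k \<noteq> \<one>} \<in> sets \<Omega>"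
    by (intro sets.sets_Collect_finite_All sets_walk) simp
  then have "{\<omega> \<in> space \<Omega>. walk G \<omega> n = \<one>} \<inter>
      {\<omega> \<in> space \<Omega>. \<forall>k\<in>{1..<n}. walk G \<omega> k \<noteq> \<one>} \<in> sets \<Omega>"
    by (rule sets.Int[OF sets_walk_eq])
  moreover have "first_return n = (if 1 \<le> n then {\<omega> \<in> space \<Omega>. walk G \<omega> n = \<one>} \<inter>
      {\<omega> \<in> space \<Omega>. \<forall>k\<in>{1..<n}. walk G \<omega> k \<noteq> \<one>} else {})"
    by (auto simp: first_return_def)
  ultimately show ?thesis by simp
qed

lemma disjoint_first_return: "disjoint_family_on first_return I"
  unfolding disjoint_family_on_def first_return_def by (auto) (metis linorder_neqE_nat)

lemma return_eq_first_return:
  "1 \<le> n \<Longrightarrow> {\<omega> \<in> space \<Omega>. walk G \<omega> n = \<one>} =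
     (\<Union>k\<in>{..n}. first_return k \<inter> {\<omega> \<in> space \<Omega>. walk G \<omega> n = \<one>})"
proof (intro equalityI subsetI)
  fix \<omega> assume n: "1 \<le> n" and \<omega>: "\<omega> \<in> {\<omega> \<in> space \<Omega>. walk G \<omega> n = \<one>}"
  define k where "k = (LEAST k. 1 \<le> k \<and> walk G \<omega> k = \<one>)"
  have "1 \<le> k \<and> walk G \<omega> k = \<one>" and "k \<le> n"
    unfolding k_def using n \<omega> by (auto intro: LeastI2 Least_le)
  moreover have "walk G \<omega> i \<noteq> \<one>" if "1 \<le> i" "i < k" for i
    using that not_less_Least[of i "\<lambda>k. 1 \<le> k \<and> walk G \<omega> k = \<one>"] by (auto simp: k_def)
  ultimately show "\<omega> \<in> (\<Union>k\<in>{..n}. first_return k \<inter> {\<omega> \<in> space \<Omega>. walk G \<omega> n = \<one>})"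
    using \<omega> by (auto simp: first_return_def)
qed auto

text \<open>
  The Markov property at a deterministic time: on the event \<open>first_return k\<close> the walk stands at the
  identity at time \<open>k\<close>, so from there on it is an independent copy of itself.
\<close>

lemma prob_first_return_and_return:
  assumes "k \<le> n"
  shows "\<Omega>.prob (first_return k \<inter> {\<omega> \<in> space \<Omega>. walk G \<omega> n = \<one>}) =
    \<Omega>.prob (first_return k) * pmf (conv (n - k)) \<one>"
proof -
  define B where "B = {\<omega> \<in> space \<Omega>. walk G \<omega> n = \<one>}"
  define C where "C = {\<omega> \<in> space \<Omega>. walk G \<omega> (n - k) = \<one>}"
  have splice: "comb_seq k \<omega> \<omega>' \<in> first_return k \<inter> B \<longleftrightarrow> \<omega> \<in> first_return k \<and> \<omega>' \<in> C"
    if "\<omega> \<in> space \<Omega>" "\<omega>' \<in> space \<Omega>" for \<omega> \<omega>'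
  proof -
    have "walk G (comb_seq k \<omega> \<omega>') n = walk G \<omega> k \<otimes> walk G \<omega>' (n - k)"
      using walk_comb_seq_add[OF that, of k "n - k"] assms by simp
    then show ?thesis using that walk_closed[OF that(2)]
      by (auto simp: B_def C_def first_return_def comb_seq_space walk_comb_seq_le)
  qed
  have *: "{z \<in> space \<Omega> \<times> space \<Omega>. comb_seq k (fst z) (snd z) \<in> first_return k \<inter> B} =
      first_return k \<times> C"
  proof (rule Set.set_eqI)
    have sub: "first_return k \<subseteq> space \<Omega>" "C \<subseteq> space \<Omega>" by (auto simp: first_return_def C_def)
    fix z
    show "z \<in> {z \<in> space \<Omega> \<times> space \<Omega>. comb_seq k (fst z) (snd z) \<in> first_return k \<inter> B} \<longleftrightarrow>
        z \<in> first_return k \<times> C"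
      using splice[of "fst z" "snd z"] sub by (cases z) auto
  qed
  have sets: "B \<in> sets \<Omega>" "C \<in> sets \<Omega>" unfolding B_def C_def by (rule sets_walk_eq)+
  have "emeasure \<Omega> (first_return k \<inter> B) = emeasure (\<Omega> \<Otimes>\<^sub>M \<Omega>) (first_return k \<times> C)"
    unfolding *[symmetric] by (intro emeasure_comb_seq sets.Int sets_first_return sets)
  also have "\<dots> = emeasure \<Omega> (first_return k) * emeasure \<Omega> C"
    by (intro \<Omega>.emeasure_pair_measure_Times sets_first_return sets)
  also have "emeasure \<Omega> C = pmf (conv (n - k)) \<one>"
    by (simp add: C_def \<Omega>.emeasure_eq_measure walk_law)
  finally show ?thesis
    by (simp add: B_def \<Omega>.emeasure_eq_measure flip: ennreal_mult)
qed

text \<open>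
  One half of the renewal equation: a return at time \<open>n\<close> is split according to the time of the
  first one, and the walk restarts from there.
\<close>

lemma conv_one_renewal:
  "pmf (conv n) \<one> \<le> (if n = 0 then 1 else 0) +
     (\<Sum>k\<le>n. \<Omega>.prob (first_return k) * pmf (conv (n - k)) \<one>)"
proof (cases "n = 0")
  case False
  let ?B = "{\<omega> \<in> space \<Omega>. walk G \<omega> n = \<one>}"
  have "pmf (conv n) \<one> = \<Omega>.prob (\<Union>k\<in>{..n}. first_return k \<inter> ?B)"
    using return_eq_first_return[of n] False walk_law[of \<one> n] by simp
  also have "\<dots> \<le> (\<Sum>k\<le>n. \<Omega>.prob (first_return k \<inter> ?B))"
    by (intro \<Omega>.finite_measure_subadditive_finite)
      (auto intro!: sets.Int sets_first_return sets_walk_eq)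
  also have "\<dots> = (\<Sum>k\<le>n. \<Omega>.prob (first_return k) * pmf (conv (n - k)) \<one>)"
    by (intro sum.cong) (simp_all add: prob_first_return_and_return)
  finally show ?thesis using False by simp
qed (simp add: sum_nonneg)

lemma sum_first_return_le:
  "(\<Sum>k\<le>n. \<Omega>.prob (first_return k)) \<le> path_prob G \<mu> (\<lambda>\<omega>. \<exists>n\<ge>1. walk G \<omega> n = \<one>)"
proof -
  have "(\<Sum>k\<le>n. \<Omega>.prob (first_return k)) = \<Omega>.prob (\<Union>k\<in>{..n}. first_return k)"
    by (intro \<Omega>.finite_measure_finite_Union[symmetric] disjoint_first_return)
      (auto intro: sets_first_return)
  also have "\<dots> \<le> path_prob G \<mu> (\<lambda>\<omega>. \<exists>n\<ge>1. walk G \<omega> n = \<one>)"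
    unfolding path_prob_def
  proof (rule \<Omega>.finite_measure_mono)
    have "{\<omega> \<in> space \<Omega>. \<exists>n\<ge>1. walk G \<omega> n = \<one>} =
        (\<Union>n\<in>{1..}. {\<omega> \<in> space \<Omega>. walk G \<omega> n = \<one>})" by auto
    then show "{\<omega> \<in> space \<Omega>. \<exists>n\<ge>1. walk G \<omega> n = \<one>} \<in> sets \<Omega>"
      by (auto intro!: sets.countable_UN'' sets_walk_eq)
  qed (auto simp: first_return_def)
  finally show ?thesis .
qed

text \<open>
  Let $U_n$ be the sum of $\mu^{(i)}(e)$ over $i \le n$ and let $q$ be the probability of ever
  returning.  Summing the renewal equation gives $U_n \le 1 + q\,U_n$, that is
  $U_n \le 1/(1-q)$, since the first-return probabilities add up to at most $q$.
\<close>

lemma transient_summable: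
  assumes "transient G \<mu>"
  shows "summable (\<lambda>n. pmf (conv n) \<one>)"
proof (rule summableI_nonneg_bounded)
  let ?u = "\<lambda>n. pmf (conv n) \<one>" and ?f = "\<lambda>k. \<Omega>.prob (first_return k)"
  define q where "q = path_prob G \<mu> (\<lambda>\<omega>. \<exists>n\<ge>1. walk G \<omega> n = \<one>)"
  have q: "q < 1" using assms by (simp add: transient_def q_def)
  show "sum ?u {..<n} \<le> 1 / (1 - q)" for n
  proof -
    let ?U = "sum ?u {..n}"
    have "?U \<le> (\<Sum>i\<le>n. (if i = 0 then 1 else 0) + (\<Sum>k\<le>i. ?f k * ?u (i - k)))"
      by (intro sum_mono conv_one_renewal)
    also have "\<dots> = 1 + (\<Sum>i\<le>n. \<Sum>k\<le>i. ?f k * ?u (i - k))"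
      by (simp add: sum.distrib)
    also have "(\<Sum>i\<le>n. \<Sum>k\<le>i. ?f k * ?u (i - k)) = (\<Sum>(k, i)\<in>{(k, i). k + i \<le> n}. ?f k * ?u i)"
      by (rule sum.triangle_reindex_eq[symmetric])
    also have "\<dots> \<le> (\<Sum>(k, i)\<in>{..n} \<times> {..n}. ?f k * ?u i)"
      by (intro sum_mono2) auto
    also have "\<dots> = sum ?f {..n} * ?U"
      by (simp add: sum_product sum.cartesian_product)
    also have "\<dots> \<le> q * ?U"
      unfolding q_def by (intro mult_right_mono sum_first_return_le sum_nonneg) simp
    finally have "?U * (1 - q) \<le> 1" by (simp add: algebra_simps)
    then have "?U \<le> 1 / (1 - q)" using q by (simp add: field_simps)
    moreover have "sum ?u {..<n} \<le> ?U" by (intro sum_mono2) auto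
    ultimately show ?thesis by simp
  qed
qed simp

end

section \<open>The Green function and the Martin kernel\<close>

locale transient_walk = generated_group + group_law +
  assumes infinite: "infinite (carrier G)"
    and symmetric: "symmetric_law G \<mu>"
    and nondegenerate: "nondegenerate G \<mu>"
    and transient: "transient G \<mu>"
begin

sublocale group_walk
  by unfold_locales (rule countable_carrier)

abbreviation gr :: "'a \<Rightarrow> real" where
  "gr \<equiv> green G \<mu> \<one>"

abbreviation K :: "'a \<Rightarrow> 'a \<Rightarrow> real" where
  "K \<equiv> martin_kernel G \<mu>"

lemma green_translate: "green G \<mu> x z = gr (inv x \<otimes> z)" if "x \<in> carrier G" "z \<in> carrier G"
  using that by (simp add: green_def)

lemma gr_eq: "z \<in> carrier G \<Longrightarrow> gr z = (\<Sum>n. pmf (conv n) z)"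
  by (simp add: green_def)

lemma conv_positive: "x \<in> carrier G \<Longrightarrow> \<exists>n. pmf (conv n) x > 0"
  using conv_positive_on_semigroup nondegenerate by (simp add: nondegenerate_def)

text \<open>
  A walk that reaches \<open>z\<close> can go on to the identity with a fixed positive probability, so the
  expected number of visits to \<open>z\<close> is controlled by that of visits to the identity.
\<close>

lemma summable_conv:
  assumes z: "z \<in> carrier G"
  shows "summable (\<lambda>n. pmf (conv n) z)"
proof -
  obtain m where m: "pmf (conv m) (inv z) > 0" using conv_positive z by blast
  have "summable (\<lambda>n. pmf (conv (n + m)) \<one> / pmf (conv m) (inv z))"
    by (intro summable_divide summable_ignore_initial_segment transient_summable transient)
  then show ?thesis
  proof (rule summable_comparison_test'[where N = 0])
    fix n
    have "pmf (conv n) z * pmf (conv m) (inv z) \<le> pmf (conv (n + m)) \<one>"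
      using conv_add_ge[of n z m "inv z"] z by simp
    then show "norm (pmf (conv n) z) \<le> pmf (conv (n + m)) \<one> / pmf (conv m) (inv z)"
      using m by (simp add: field_simps)
  qed
qed

lemma gr_pos:
  assumes "z \<in> carrier G"
  shows "gr z > 0"
proof -
  obtain n where "pmf (conv n) z > 0" using conv_positive assms by blast
  then show ?thesis unfolding gr_eq[OF assms] by (intro suminf_pos2[OF summable_conv[OF assms]]) auto
qed

lemma gr_inv: "z \<in> carrier G \<Longrightarrow> gr (inv z) = gr z"
  by (simp add: gr_eq conv_symmetric symmetric)

text \<open>
  The elementary Harnack inequality: one of the ways to reach \<open>h \<otimes> z\<close> is to move by \<open>h\<close> in
  the first \<open>m\<close> steps and by \<open>z\<close> afterwards.
\<close>

lemma gr_ge_conv_mult: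
  assumes h: "h \<in> carrier G" and z: "z \<in> carrier G"
  shows "pmf (conv m) h * gr z \<le> gr (h \<otimes> z)"
proof -
  have hz: "h \<otimes> z \<in> carrier G" using h z by simp
  have "pmf (conv m) h * gr z = (\<Sum>n. pmf (conv m) h * pmf (conv n) z)"
    unfolding gr_eq[OF z] by (rule suminf_mult[OF summable_conv[OF z], symmetric])
  also have "\<dots> \<le> (\<Sum>n. pmf (conv (n + m)) (h \<otimes> z))"
    using conv_add_ge[of m h _ z]
    by (intro suminf_le summable_mult summable_conv z
        summable_ignore_initial_segment[OF summable_conv[OF hz]]) (simp add: add.commute)
  also have "\<dots> \<le> gr (h \<otimes> z)"
    unfolding gr_eq[OF hz] using suminf_split_initial_segment[OF summable_conv[OF hz], of m]
    by (simp add: sum_nonneg)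
  finally show ?thesis .
qed

lemma gr_generator_bound: "\<exists>c>1. \<forall>t\<in>T. \<forall>z\<in>carrier G. gr (inv t \<otimes> z) \<le> c * gr z"
proof -
  have "\<exists>a>0. \<forall>z\<in>carrier G. gr (inv t \<otimes> z) \<le> a * gr z" if t: "t \<in> T" for t
  proof -
    have tG: "t \<in> carrier G" using t T_carrier by auto
    then obtain m where m: "pmf (conv m) t > 0" using conv_positive by blast
    have "gr (inv t \<otimes> z) \<le> (1 / pmf (conv m) t) * gr z" if z: "z \<in> carrier G" for z
      using gr_ge_conv_mult[OF tG, of "inv t \<otimes> z" m] tG z m
      by (simp add: field_simps m_assoc[symmetric])
    then show ?thesis using m by (intro exI[of _ "1 / pmf (conv m) t"]) simp
  qed
  then obtain a where a: "\<And>t. t \<in> T \<Longrightarrow> a t > 0"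
    "\<And>t z. t \<in> T \<Longrightarrow> z \<in> carrier G \<Longrightarrow> gr (inv t \<otimes> z) \<le> a t * gr z" by metis
  define c where "c = 2 + sum a T"
  have a_le: "a t \<le> c" if "t \<in> T" for t
  proof -
    have "a t \<le> sum a T" using a(1) by (intro member_le_sum finite_T that) (simp add: less_imp_le)
    then show ?thesis by (simp add: c_def)
  qed
  have "gr (inv t \<otimes> z) \<le> c * gr z" if "t \<in> T" "z \<in> carrier G" for t z
    using a(2)[OF that] mult_right_mono[OF a_le[OF that(1)] less_imp_le[OF gr_pos[OF that(2)]]]
    by (rule order_trans)
  moreover have "c > 1"
  proof -
    have "sum a T \<ge> 0" using a(1) by (intro sum_nonneg) (simp add: less_imp_le)
    then show ?thesis by (simp add: c_def)
  qed
  ultimately show ?thesis by blast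
qed

lemma K_eq: "x \<in> carrier G \<Longrightarrow> z \<in> carrier G \<Longrightarrow> K x z = gr (inv x \<otimes> z) / gr z"
  by (simp add: martin_kernel_def green_translate[of x z])

lemma K_pos: "x \<in> carrier G \<Longrightarrow> z \<in> carrier G \<Longrightarrow> K x z > 0"
  by (simp add: K_eq gr_pos)

lemma K_one: "z \<in> carrier G \<Longrightarrow> K \<one> z = 1"
  using gr_pos[of z] by (simp add: K_eq)

text \<open>
  The cocycle identity; both the multiplicativity of limits of the kernel and the exponential
  bound below come from it.
\<close>

lemma K_mult:
  assumes "x \<in> carrier G" "y \<in> carrier G" "z \<in> carrier G"
  shows "K (x \<otimes> y) z = K x z * K y (inv x \<otimes> z)"
  using assms gr_pos[of "inv x \<otimes> z"] by (simp add: K_eq inv_mult_group m_assoc)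

text \<open>
  The Harnack inequality applied once for each letter of a geodesic word; what matters later is that
  the bound is the same for all \<open>z\<close>.
\<close>

lemma K_exponential_bound:
  "\<exists>c>1. \<forall>x\<in>carrier G. \<forall>z\<in>carrier G. K x z \<le> c ^ len x"
proof -
  obtain c where c: "c > 1" "\<And>t z. t \<in> T \<Longrightarrow> z \<in> carrier G \<Longrightarrow> gr (inv t \<otimes> z) \<le> c * gr z"
    using gr_generator_bound by blast
  have "K x z \<le> c ^ n" if "x \<in> carrier G" "z \<in> carrier G" "len x = n" for x z n
    using that
  proof (induction n arbitrary: x z)
    case 0
    then show ?case using word_length_eq_0 K_one by simp
  next
    case (Suc n)
    obtain t y where t: "t \<in> T" and y: "y \<in> carrier G" "x = t \<otimes> y" "len y = n"
      using Suc.prems(1,3) by (rule geodesic_step)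
    have tG: "t \<in> carrier G" using t T_carrier by auto
    have "K t z \<le> c" using c(2)[OF t Suc.prems(2)] gr_pos[OF Suc.prems(2)] tG Suc.prems(2)
      by (simp add: K_eq field_simps)
    moreover have "K y (inv t \<otimes> z) \<le> c ^ n" using Suc.IH y tG Suc.prems(2) by simp
    ultimately have "K t z * K y (inv t \<otimes> z) \<le> c * c ^ n"
      using c(1) y tG Suc.prems(2) by (intro mult_mono) (auto intro: less_imp_le K_pos)
    then show ?case using y tG Suc.prems(2) by (simp add: K_mult)
  qed
  then show ?thesis using c(1) by blast
qed

text \<open>
  Condition on the first step; the term of time zero vanishes because \<open>z\<close> is not the identity.
  Stating the average as an integral over nonnegative extended reals allows exchanging it with the
  sum over time without an integrability argument.
\<close>

lemma gr_poisson:
  assumes z: "z \<in> carrier G" and "z \<noteq> \<one>"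
  shows "(\<integral>\<^sup>+h. gr (inv h \<otimes> z) \<partial>measure_pmf \<mu>) = gr z"
proof -
  have Suc: "ennreal (pmf (conv (Suc n)) z) = (\<integral>\<^sup>+h. pmf (conv n) (inv h \<otimes> z) \<partial>measure_pmf \<mu>)" for n
    unfolding conv_Suc_left convolution_bind ennreal_pmf_bind
    by (intro nn_integral_cong_AE, unfold AE_measure_pmf_iff, intro ballI)
      (simp add: pmf_map_left_translate[OF set_conv] z subsetD[OF supp])
  have "ennreal (gr z) = (\<Sum>n. ennreal (pmf (conv n) z))"
    unfolding gr_eq[OF z] using summable_conv[OF z] by (intro suminf_ennreal2[symmetric]) auto
  also have "\<dots> = (\<Sum>n. ennreal (pmf (conv (Suc n)) z))"
  proof -
    have "(\<Sum>n. ennreal (pmf (conv n) z)) =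
        (\<Sum>n. ennreal (pmf (conv (n + 1)) z)) + (\<Sum>n<1. ennreal (pmf (conv n) z))"
      by (rule suminf_offset) (rule summableI)
    also have "(\<Sum>n<1. ennreal (pmf (conv n) z)) = 0" using \<open>z \<noteq> \<one>\<close> by simp
    finally show ?thesis by (simp only: add_0_right Suc_eq_plus1)
  qed
  also have "\<dots> = (\<integral>\<^sup>+h. (\<Sum>n. ennreal (pmf (conv n) (inv h \<otimes> z))) \<partial>measure_pmf \<mu>)"
    unfolding Suc by (rule nn_integral_suminf[symmetric]) simp
  also have "\<dots> = (\<integral>\<^sup>+h. gr (inv h \<otimes> z) \<partial>measure_pmf \<mu>)"
  proof (intro nn_integral_cong_AE, unfold AE_measure_pmf_iff, intro ballI)
    fix h assume "h \<in> set_pmf \<mu>"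
    then have hz: "inv h \<otimes> z \<in> carrier G" using supp z by auto
    show "(\<Sum>n. ennreal (pmf (conv n) (inv h \<otimes> z))) = ennreal (gr (inv h \<otimes> z))"
      unfolding gr_eq[OF hz] using summable_conv[OF hz] by (intro suminf_ennreal2) auto
  qed
  finally show ?thesis ..
qed

lemma K_poisson:
  assumes x: "x \<in> carrier G" and z: "z \<in> carrier G" and "z \<noteq> x"
  shows "K x z = (\<integral>h. K (x \<otimes> h) z \<partial>measure_pmf \<mu>)"
proof -
  have ne: "inv x \<otimes> z \<noteq> \<one>"
    using x z \<open>z \<noteq> x\<close> by (metis inv_closed inv_equality inv_inv)
  have gr_nonneg: "AE h in measure_pmf \<mu>. 0 \<le> gr (inv h \<otimes> (inv x \<otimes> z))"
    using supp x z by (auto simp: AE_measure_pmf_iff intro!: less_imp_le gr_pos)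
  have "(\<integral>h. gr (inv h \<otimes> (inv x \<otimes> z)) \<partial>measure_pmf \<mu>) = gr (inv x \<otimes> z)"
    using gr_poisson[OF _ ne] x z gr_pos[of "inv x \<otimes> z"] gr_nonneg
    by (simp add: integral_eq_nn_integral)
  moreover have "(\<integral>h. K (x \<otimes> h) z \<partial>measure_pmf \<mu>) =
      (\<integral>h. gr (inv h \<otimes> (inv x \<otimes> z)) / gr z \<partial>measure_pmf \<mu>)"
    using supp x z by (intro integral_cong_AE)
      (auto simp: AE_measure_pmf_iff K_eq inv_mult_group m_assoc subset_eq)
  ultimately show ?thesis using x z by (simp add: K_eq)
qed

section \<open>Convergence of the Martin kernel at at_inf\<close>

text \<open>
  The filter of cofinite subsets of the carrier, so that convergence along it means convergence as
  the group element leaves every finite set.  The carrier may be a proper subset of its type, hence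
  the intersection.
\<close>

abbreviation at_inf :: "'a filter" where
  "at_inf \<equiv> inf cofinite (principal (carrier G))"

lemma eventually_at_inf: "eventually P at_inf \<longleftrightarrow> finite {z \<in> carrier G. \<not> P z}"
  by (simp add: eventually_inf_principal eventually_cofinite)

lemma at_inf_neq_bot: "at_inf \<noteq> bot"
  unfolding trivial_limit_def eventually_at_inf using infinite by simp

lemma eventually_at_inf_carrier: "eventually (\<lambda>z. z \<in> carrier G) at_inf"
  by (simp add: eventually_at_inf)

lemma filterlim_at_inf:
  assumes "inj_on f (carrier G)" "f ` carrier G \<subseteq> carrier G"
  shows "filterlim f at_inf at_inf"
  unfolding filterlim_iff eventually_at_inf
proof (intro allI impI)
  fix P assume "finite {z \<in> carrier G. \<not> P z}"
  then have "finite (f -` {z \<in> carrier G. \<not> P z} \<inter> carrier G)"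
    using assms(1) by (rule finite_vimage_IntI)
  moreover have "{z \<in> carrier G. \<not> P (f z)} = f -` {z \<in> carrier G. \<not> P z} \<inter> carrier G"
    using assms(2) by auto
  ultimately show "finite {z \<in> carrier G. \<not> P (f z)}" by simp
qed

lemma filterlim_left_translate: "x \<in> carrier G \<Longrightarrow> filterlim (\<lambda>z. x \<otimes> z) at_inf at_inf"
  by (rule filterlim_at_inf) (auto simp: inj_on_def)

lemma filterlim_right_translate: "x \<in> carrier G \<Longrightarrow> filterlim (\<lambda>z. z \<otimes> x) at_inf at_inf"
  by (rule filterlim_at_inf) (auto simp: inj_on_def)

lemma filterlim_inv: "filterlim (\<lambda>z. inv z) at_inf at_inf"
  by (rule filterlim_at_inf) (auto simp: inj_on_def intro: inv_inj[THEN inj_onD])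

lemma filterlim_powers:
  assumes x: "x \<in> carrier G" and inj: "inj (\<lambda>n::nat. x [^] n)"
  shows "filterlim (\<lambda>n::nat. x [^] n) at_inf sequentially"
  unfolding filterlim_iff eventually_at_inf
proof (intro allI impI)
  fix P assume "finite {z \<in> carrier G. \<not> P z}"
  then have "finite ((\<lambda>n::nat. x [^] n) -` {z \<in> carrier G. \<not> P z})"
    using inj by (intro finite_vimageI)
  then have "eventually (\<lambda>n. \<not> n \<in> (\<lambda>n::nat. x [^] n) -` {z \<in> carrier G. \<not> P z}) sequentially"
    unfolding cofinite_eq_sequentially[symmetric] eventually_cofinite by simp
  then show "eventually (\<lambda>n. P (x [^] n)) sequentially"
    by (rule eventually_mono) (simp add: x)
qed

text \<open>
  The limits form a homomorphism into the positive reals.  For \<open>x\<close> of infinite order both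
  factors of $K(x,z^{-1})\,K(x,zx)$ tend to $L(x)$, while by symmetry of the Green function the
  product equals $g(zx)\,g(x^{-1}zx)/(g(z)\,g(zx)) = g(x^{-1}zx)/g(z)$, which is $1$ whenever \<open>z\<close> is a
  power of \<open>x\<close>.  For \<open>x\<close> of finite order it is enough that $1$ is the only positive root of
  unity.
\<close>

lemma kernel_limit_trivial:
  assumes L: "\<And>x. x \<in> carrier G \<Longrightarrow> (K x \<longlongrightarrow> L x) at_inf"
    and x: "x \<in> carrier G"
  shows "L x = 1"
proof -
  have nonneg: "L y \<ge> 0" if "y \<in> carrier G" for y
  proof (rule tendsto_lowerbound[OF L[OF that] _ at_inf_neq_bot])
    show "\<forall>\<^sub>F z in at_inf. 0 \<le> K y z"
      by (rule eventually_mono[OF eventually_at_inf_carrier]) (simp add: K_pos that less_imp_le)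
  qed
  have L_one: "L \<one> = 1"
  proof (rule tendsto_unique[OF at_inf_neq_bot L])
    show "(K \<one> \<longlongrightarrow> 1) at_inf"
      by (rule tendsto_eventually, rule eventually_mono[OF eventually_at_inf_carrier]) (rule K_one)
  qed simp
  have L_mult: "L (u \<otimes> v) = L u * L v" if u: "u \<in> carrier G" and v: "v \<in> carrier G" for u v
  proof (rule tendsto_unique[OF at_inf_neq_bot L])
    have "((\<lambda>z. K v (inv u \<otimes> z)) \<longlongrightarrow> L v) at_inf"
      using u by (intro filterlim_compose[OF L[OF v]] filterlim_left_translate) simp
    then have "((\<lambda>z. K u z * K v (inv u \<otimes> z)) \<longlongrightarrow> L u * L v) at_inf"
      by (intro tendsto_mult L u)
    then show "(K (u \<otimes> v) \<longlongrightarrow> L u * L v) at_inf"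
      by (rule Lim_transform_eventually)
        (auto intro!: eventually_mono[OF eventually_at_inf_carrier] simp: K_mult u v)
  qed (simp add: u v)
  have L_pow: "L (x [^] n) = L x ^ n" for n :: nat
    by (induction n) (simp_all add: L_one L_mult x)
  show ?thesis
  proof (cases "inj (\<lambda>n::nat. x [^] n)")
    case True
    have "((\<lambda>z. K x (inv z) * K x (z \<otimes> x)) \<longlongrightarrow> L x * L x) at_inf"
      by (intro tendsto_mult filterlim_compose[OF L[OF x] filterlim_inv]
          filterlim_compose[OF L[OF x] filterlim_right_translate] x)
    then have "((\<lambda>n::nat. K x (inv (x [^] n)) * K x (x [^] n \<otimes> x)) \<longlongrightarrow> L x * L x) sequentially"
      by (rule filterlim_compose[OF _ filterlim_powers[OF x True]])
    moreover have "K x (inv (x [^] n)) * K x (x [^] n \<otimes> x) = 1" for n :: nat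
    proof -
      have pow: "x [^] n \<in> carrier G" "x [^] n \<otimes> x = x \<otimes> x [^] n"
        using x nat_pow_comm[of x n 1] by simp_all
      have "K x (inv (x [^] n)) = gr (inv (x [^] n \<otimes> x)) / gr (inv (x [^] n))"
        using x pow(1) by (simp add: K_eq inv_mult_group)
      also have "\<dots> = gr (x [^] n \<otimes> x) / gr (x [^] n)"
        using x pow(1) gr_inv[of "x [^] n \<otimes> x"] gr_inv[of "x [^] n"] by simp
      finally show ?thesis
        using x pow gr_pos[of "x \<otimes> x [^] n"] gr_pos[of "x [^] n"]
        by (simp add: K_eq m_assoc[symmetric])
    qed
    ultimately have "L x * L x = 1" by (simp add: tendsto_const_iff)
    then show ?thesis using nonneg[OF x] by (metis abs_of_nonneg abs_1 abs_eq_iff square_eq_1_iff)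
  next
    case False
    then obtain m n :: nat where mn: "m < n" "x [^] m = x [^] n"
      unfolding inj_def by (metis linorder_neqE_nat)
    have "x [^] m \<otimes> x [^] (n - m) = x [^] m" using mn nat_pow_mult[OF x, of m "n - m"] by simp
    then have "x [^] (n - m) = \<one>" using x by simp
    then have "L x ^ (n - m) = 1" using L_pow[of "n - m"] L_one by simp
    then show ?thesis using mn(1) nonneg[OF x] power_eq_imp_eq_base[of "L x" "n - m" 1] by simp
  qed
qed

end

text \<open>
  Where the boundary is a single point, the set of points sent outside a neighbourhood of the value
  at the boundary is compact and consists of isolated points, so it is finite.
\<close>

lemma one_point_boundary_tendsto:
  assumes C: "compactification A C j" and p: "topspace C - j ` A = {p}"
    and h: "continuous_map C euclideanreal h"
  shows "((\<lambda>z. h (j z)) \<longlongrightarrow> h p) (inf cofinite (principal A))"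
proof (rule topological_tendstoI)
  fix S :: "real set" assume S: "open S" "h p \<in> S"
  define V where "V = {q \<in> topspace C. h q \<notin> S}"
  have hom: "homeomorphic_map (discrete_topology A) (subtopology C (j ` A)) j"
    using C by (simp add: compactification_def embedding_map_def)
  have jA: "j ` A \<subseteq> topspace C" by (rule compactification_subset[OF C])
  have pC: "p \<in> topspace C" using p by blast
  have "V = topspace C - {q \<in> topspace C. h q \<in> S}" by (auto simp: V_def)
  moreover have "openin C {q \<in> topspace C. h q \<in> S}"
    using openin_continuous_map_preimage[OF h, of S] S by simp
  ultimately have "closedin C V" using closedin_diff[OF closedin_topspace] by metis
  then have V: "compactin C V"
    using C by (intro closedin_compact_space) (simp_all add: compactification_def)
  have "closedin C {p}"
    using C pC by (simp add: compactification_def closedin_Hausdorff_sing_eq)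
  moreover have "j ` A = topspace C - {p}" using p jA by blast
  ultimately have jA_open: "openin C (j ` A)" by auto
  have point_open: "openin C {j z}" if "z \<in> A" for z
  proof -
    have "openin (subtopology C (j ` A)) (j ` {z})"
      using homeomorphic_imp_open_map[OF hom] that unfolding open_map_def
      by (metis empty_subsetI insert_subset openin_discrete_topology)
    then show ?thesis using openin_open_subtopology[OF jA_open] by simp
  qed
  have V_sub: "V \<subseteq> \<Union>((\<lambda>z. {j z}) ` A)" using p S(2) by (auto simp: V_def)
  have "\<exists>F. finite F \<and> F \<subseteq> (\<lambda>z. {j z}) ` A \<and> V \<subseteq> \<Union>F"
    by (rule compactinD[OF V _ V_sub]) (auto intro: point_open)
  then obtain F where F: "finite F" "F \<subseteq> (\<lambda>z. {j z}) ` A" "V \<subseteq> \<Union>F" by blast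
  then have "finite (\<Union>F)" by (intro finite_Union) auto
  then have "finite V" using F(3) finite_subset by blast
  moreover have "inj_on j A" using homeomorphic_imp_injective_map[OF hom] by simp
  ultimately have "finite (j -` V \<inter> A)" by (rule finite_vimage_IntI)
  then have "finite {z \<in> A. h (j z) \<notin> S}"
    by (rule rev_finite_subset) (use jA in \<open>auto simp: V_def\<close>)
  then show "\<forall>\<^sub>F z in inf cofinite (principal A). h (j z) \<in> S"
    by (simp add: eventually_inf_principal eventually_cofinite)
qed

context transient_walk
begin

lemma kernel_tendsto_one_if_singleton_boundary:
  assumes C: "kernel_compactification G \<mu> C j" and b: "is_singleton (martin_boundary G C j)"
    and x: "x \<in> carrier G"
  shows "(K x \<longlongrightarrow> 1) at_inf"
proof -
  obtain p where p: "topspace C - j ` carrier G = {p}"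
    using b by (auto simp: martin_boundary_def is_singleton_def)
  have "\<exists>l. (K y \<longlongrightarrow> l) at_inf" if y: "y \<in> carrier G" for y
  proof -
    have "extends_continuously (carrier G) C j (K y)" and comp: "compactification (carrier G) C j"
      using C y by (simp_all add: kernel_compactification_def)
    then obtain h where h: "continuous_map C euclideanreal h"
      "\<And>z. z \<in> carrier G \<Longrightarrow> h (j z) = K y z"
      by (auto simp: extends_continuously_def)
    have "(K y \<longlongrightarrow> h p) at_inf"
      by (rule Lim_transform_eventually[OF one_point_boundary_tendsto[OF comp p h(1)]])
        (auto intro: eventually_mono[OF eventually_at_inf_carrier] h(2))
    then show ?thesis by blast
  qed
  then obtain L where L: "\<And>y. y \<in> carrier G \<Longrightarrow> (K y \<longlongrightarrow> L y) at_inf" by metis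
  then show ?thesis using kernel_limit_trivial[of L, OF L x] L[OF x] by simp
qed

text \<open>
  Harmonicity is a statement about unordered sums over the group, dominated convergence one about
  integrals; this translates the former into the latter.
\<close>

lemma infsum_eq_expectation:
  fixes f :: "'a \<Rightarrow> real"
  assumes "integrable (measure_pmf \<mu>) f"
  shows "(\<lambda>g. \<bar>pmf \<mu> g * f g\<bar>) summable_on carrier G"
    and "(\<Sum>\<^sub>\<infinity>g\<in>carrier G. pmf \<mu> g * f g) = (\<integral>g. f g \<partial>measure_pmf \<mu>)"
proof -
  let ?w = "\<lambda>g. pmf \<mu> g * f g"
  have "integrable (count_space UNIV) ?w"
    using assms unfolding measure_pmf_eq_density by (subst (asm) integrable_density) simp_all
  then have w: "Infinite_Set_Sum.abs_summable_on ?w (carrier G)"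
    using abs_summable_on_subset[of ?w UNIV "carrier G"]
    by (simp add: Infinite_Set_Sum.abs_summable_on_def)
  then show "(\<lambda>g. \<bar>?w g\<bar>) summable_on carrier G"
    using abs_summable_equivalent[of ?w "carrier G"] by simp
  have "infsum ?w (carrier G) = infsetsum ?w (carrier G)"
    by (rule infsetsum_infsum[OF w, symmetric])
  also have "\<dots> = infsetsum ?w UNIV"
    using supp by (intro infsetsum_cong_neutral) (auto simp: set_pmf_iff)
  also have "\<dots> = (\<integral>g. f g \<partial>measure_pmf \<mu>)" by (rule pmf_expectation_eq_infsetsum[symmetric])
  finally show "infsum ?w (carrier G) = (\<integral>g. f g \<partial>measure_pmf \<mu>)" .
qed

lemma integrable_exponential_length:
  fixes c :: real
  assumes "superexponential_moments G T \<mu>" and c: "c > 1"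
  shows "integrable (measure_pmf \<mu>) (\<lambda>g. c ^ len g)"
proof -
  let ?w = "\<lambda>g. pmf \<mu> g * c ^ len g"
  have exp_eq: "exp (ln c * real (len g)) = c ^ len g" for g
    using c by (simp add: exp_of_nat2_mult)
  have "(\<lambda>g. pmf \<mu> g * exp (ln c * real (len g))) summable_on carrier G"
    using assms by (simp add: superexponential_moments_def)
  then have "(\<lambda>g. norm (?w g)) summable_on carrier G"
    using c by (simp add: exp_eq abs_mult)
  then have "Infinite_Set_Sum.abs_summable_on ?w (carrier G)"
    using abs_summable_equivalent[of ?w "carrier G"] by simp
  also have "Infinite_Set_Sum.abs_summable_on ?w (carrier G) \<longleftrightarrow>
      Infinite_Set_Sum.abs_summable_on ?w UNIV"
    using supp by (intro abs_summable_on_cong_neutral) (auto simp: set_pmf_iff)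
  finally have "integrable (count_space UNIV) ?w"
    by (simp add: Infinite_Set_Sum.abs_summable_on_def)
  then show ?thesis
    unfolding measure_pmf_eq_density by (subst integrable_density) simp_all
qed

text \<open>
  The Poisson equation holds at \<open>k\<close> as soon as the sequence has left \<open>k\<close>.  The bound
  $K(kg,z) \le c^{|k|} c^{|g|}$ does not depend on \<open>z\<close> and is integrable thanks to the
  superexponential moments, whatever \<open>c\<close> is, so the equation survives in the limit.
\<close>

lemma kernel_limit_harmonic:
  assumes mom: "superexponential_moments G T \<mu>"
    and z: "\<And>n. z n \<in> carrier G" and inj: "inj z"
    and f: "\<And>y. y \<in> carrier G \<Longrightarrow> (\<lambda>n. K y (z n)) \<longlonglongrightarrow> f y"
  shows "harmonic G \<mu> f"
  unfolding harmonic_def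
proof (rule ballI)
  fix k assume k: "k \<in> carrier G"
  obtain c where c: "c > 1" "\<And>x z. x \<in> carrier G \<Longrightarrow> z \<in> carrier G \<Longrightarrow> K x z \<le> c ^ len x"
    using K_exponential_bound by blast
  have g: "g \<in> carrier G" if "g \<in> set_pmf \<mu>" for g using that supp by blast
  have dom: "integrable (measure_pmf \<mu>) (\<lambda>g. c ^ len k * c ^ len g)"
    by (intro integrable_mult_right integrable_exponential_length mom c)
  have lim: "AE g in measure_pmf \<mu>. (\<lambda>n. K (k \<otimes> g) (z n)) \<longlonglongrightarrow> f (k \<otimes> g)"
    using g k by (simp add: AE_measure_pmf_iff f)
  have bound: "AE g in measure_pmf \<mu>. norm (K (k \<otimes> g) (z n)) \<le> c ^ len k * c ^ len g" for n
    unfolding AE_measure_pmf_iff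
  proof
    fix g assume "g \<in> set_pmf \<mu>"
    then have gG: "g \<in> carrier G" by (rule g)
    have "K (k \<otimes> g) (z n) \<le> c ^ len (k \<otimes> g)" using c(2) k gG z by simp
    also have "\<dots> \<le> c ^ (len k + len g)"
      using c(1) word_length_mult[OF k gG] by (intro power_increasing) simp_all
    finally show "norm (K (k \<otimes> g) (z n)) \<le> c ^ len k * c ^ len g"
      using K_pos[of "k \<otimes> g" "z n"] k gG z by (simp add: power_add)
  qed
  have meas: "(\<lambda>g. f (k \<otimes> g)) \<in> borel_measurable (measure_pmf \<mu>)"
    "(\<lambda>g. K (k \<otimes> g) (z n)) \<in> borel_measurable (measure_pmf \<mu>)" for n by simp_all
  have integrable: "integrable (measure_pmf \<mu>) (\<lambda>g. f (k \<otimes> g))"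
    by (rule integrable_dominated_convergence[OF meas dom lim bound])
  have "(\<lambda>n. \<integral>g. K (k \<otimes> g) (z n) \<partial>measure_pmf \<mu>) \<longlonglongrightarrow> (\<integral>g. f (k \<otimes> g) \<partial>measure_pmf \<mu>)"
    by (rule integral_dominated_convergence[OF meas dom lim bound])
  moreover have "\<forall>\<^sub>F n in sequentially. (\<integral>g. K (k \<otimes> g) (z n) \<partial>measure_pmf \<mu>) = K k (z n)"
  proof -
    have "finite (z -` {k})" using inj by (intro finite_vimageI) simp_all
    then have "\<forall>\<^sub>F n in sequentially. z n \<noteq> k"
      unfolding cofinite_eq_sequentially[symmetric] eventually_cofinite by (simp add: vimage_def)
    then show ?thesis by (rule eventually_mono) (simp add: K_poisson k z)
  qed
  ultimately have "(\<lambda>n. K k (z n)) \<longlonglongrightarrow> (\<integral>g. f (k \<otimes> g) \<partial>measure_pmf \<mu>)"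
    by (rule Lim_transform_eventually)
  then have "f k = (\<integral>g. f (k \<otimes> g) \<partial>measure_pmf \<mu>)"
    using f[OF k] LIMSEQ_unique by blast
  then show "(\<lambda>g. \<bar>pmf \<mu> g * f (k \<otimes> g)\<bar>) summable_on carrier G \<and>
      f k = (\<Sum>\<^sub>\<infinity>g\<in>carrier G. pmf \<mu> g * f (k \<otimes> g))"
    using infsum_eq_expectation[OF integrable] by simp
qed

text \<open>
  If convergence failed, some sequence going to infinity would keep $K(x,z)$ away from $1$; but a
  pointwise limit of kernels along a subsequence is a positive harmonic function, hence constant,
  with value $1$ at the identity.  Pointwise convergence on the countable group comes from a diagonal
  argument, applied to the kernels rescaled by $c^{|y|}$ so that they are uniformly bounded.
\<close>

lemma kernel_tendsto_one_if_strong_Liouville: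
  assumes SL: "strong_Liouville G \<mu>" and mom: "superexponential_moments G T \<mu>"
    and x: "x \<in> carrier G"
  shows "(K x \<longlongrightarrow> 1) at_inf"
proof (rule ccontr)
  assume "\<not> (K x \<longlongrightarrow> 1) at_inf"
  then obtain e where e: "e > 0" "infinite {z \<in> carrier G. \<not> dist (K x z) 1 < e}"
    unfolding tendsto_iff eventually_at_inf by blast
  then obtain z :: "nat \<Rightarrow> 'a" where "inj z" "range z \<subseteq> {z \<in> carrier G. \<not> dist (K x z) 1 < e}"
    using infinite_countable_subset by blast
  then have z: "inj z" "\<And>n. z n \<in> carrier G" "\<And>n. \<not> dist (K x (z n)) 1 < e" by auto
  obtain c where c: "c > 1" "\<And>x z. x \<in> carrier G \<Longrightarrow> z \<in> carrier G \<Longrightarrow> K x z \<le> c ^ len x"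
    using K_exponential_bound by blast
  have "norm (K y (z n) / c ^ len y) \<le> 1" if "y \<in> carrier G" for n y
    using c(1) c(2)[OF that z(2)] K_pos[OF that z(2)] by (simp add: abs_of_pos)
  with countable_carrier obtain s :: "nat \<Rightarrow> nat" where s: "strict_mono s"
    and conv: "\<And>y. y \<in> carrier G \<Longrightarrow> \<exists>l. (\<lambda>n. K y (z (s n)) / c ^ len y) \<longlonglongrightarrow> l"
    using function_convergent_subsequence[of "carrier G" "\<lambda>n y. K y (z n) / c ^ len y" 1] by blast
  have "\<exists>l. (\<lambda>n. K y (z (s n))) \<longlonglongrightarrow> l" if y: "y \<in> carrier G" for y
  proof -
    obtain l where "(\<lambda>n. K y (z (s n)) / c ^ len y) \<longlonglongrightarrow> l" using conv y by blast
    then have "(\<lambda>n. c ^ len y * (K y (z (s n)) / c ^ len y)) \<longlonglongrightarrow> c ^ len y * l"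
      by (rule tendsto_mult_left)
    then show ?thesis using c(1) by auto
  qed
  then obtain f where f: "\<And>y. y \<in> carrier G \<Longrightarrow> (\<lambda>n. K y (z (s n))) \<longlonglongrightarrow> f y" by metis
  have "inj (\<lambda>n. z (s n))" using z(1) strict_mono_eq[OF s] by (metis injD injI)
  then have "harmonic G \<mu> f" by (intro kernel_limit_harmonic[OF mom z(2) _ f])
  moreover have "f y > 0" if y: "y \<in> carrier G" for y
  proof -
    \<comment> \<open>The upper bound at the inverse of \<open>y\<close> is a lower bound at \<open>y\<close>, uniform along the sequence.\<close>
    have "K y (z (s n)) \<ge> 1 / c ^ len (inv y)" for n
    proof -
      have "1 = K y (z (s n)) * K (inv y) (inv y \<otimes> z (s n))"
        using K_mult[of y "inv y" "z (s n)"] y z(2) K_one by simp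
      also have "\<dots> \<le> K y (z (s n)) * c ^ len (inv y)"
        using y z(2) by (intro mult_left_mono c(2)) (auto intro: less_imp_le K_pos)
      finally show ?thesis using c(1) by (simp add: field_simps)
    qed
    then have "1 / c ^ len (inv y) \<le> f y"
      by (intro LIMSEQ_le_const[OF f[OF y]]) blast
    moreover have "1 / c ^ len (inv y) > 0" using c(1) by simp
    ultimately show ?thesis by linarith
  qed
  ultimately have "harmonic G \<mu> f \<and> (\<forall>k\<in>carrier G. f k > 0)" by simp
  then have "\<exists>a. \<forall>k\<in>carrier G. f k = a"
    by (rule SL[unfolded strong_Liouville_def, THEN spec, THEN mp])
  then obtain a where a: "\<And>y. y \<in> carrier G \<Longrightarrow> f y = a" by auto
  have "(\<lambda>n. K \<one> (z (s n))) \<longlonglongrightarrow> f \<one>" by (rule f) simp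
  then have "f \<one> = 1" using K_one z(2) by (simp add: tendsto_const_iff)
  then have "(\<lambda>n. K x (z (s n))) \<longlonglongrightarrow> 1" using f[OF x] a[OF x] a[of \<one>] by simp
  then have "\<forall>\<^sub>F n in sequentially. dist (K x (z (s n))) 1 < e" using e(1) by (rule tendstoD)
  then show False using z(3) by (auto simp: eventually_sequentially)
qed

section \<open>Sublinear growth of the Green distance\<close>

text \<open>
  Let \<open>E\<close> be the finite set of points where some generator changes $\log g$ by at least \<open>e\<close>, and
  let \<open>B\<close> bound the Green distance on \<open>E\<close>.  By induction on the length, a point of \<open>E\<close> is covered
  by \<open>B\<close> alone, and any other point gains less than \<open>e\<close> over the next shorter point on a
  geodesic.
\<close>

lemma green_dist_le:
  assumes K_lim: "\<And>x. x \<in> carrier G \<Longrightarrow> (K x \<longlongrightarrow> 1) at_inf" and "e > 0"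
  shows "\<exists>B. \<forall>z\<in>carrier G. \<bar>green_dist G \<mu> \<one> z\<bar> \<le> B + e * real (len z)"
proof -
  let ?d = "green_dist G \<mu> \<one>"
  have "\<forall>\<^sub>F z in at_inf. \<forall>t\<in>T. \<bar>ln (K t z)\<bar> < e"
  proof (intro eventually_ball_finite finite_T ballI)
    fix t assume "t \<in> T"
    then have "((\<lambda>z. ln (K t z)) \<longlongrightarrow> ln 1) at_inf"
      using T_carrier by (intro tendsto_ln K_lim) auto
    then have "\<forall>\<^sub>F z in at_inf. dist (ln (K t z)) (ln 1) < e" using \<open>e > 0\<close> by (rule tendstoD)
    then show "\<forall>\<^sub>F z in at_inf. \<bar>ln (K t z)\<bar> < e" by (simp add: dist_real_def)
  qed
  then have fin: "finite {z \<in> carrier G. \<not> (\<forall>t\<in>T. \<bar>ln (K t z)\<bar> < e)}" (is "finite ?E")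
    by (simp only: eventually_at_inf)
  define B where "B = (\<Sum>z\<in>?E. \<bar>?d z\<bar>)"
  have B: "\<bar>?d z\<bar> \<le> B" if "z \<in> ?E" for z
    unfolding B_def using member_le_sum[OF that, of "\<lambda>z. \<bar>?d z\<bar>"] fin by simp
  have "B \<ge> 0" unfolding B_def by (simp add: sum_nonneg)
  have "\<bar>?d z\<bar> \<le> B + e * real n" if "z \<in> carrier G" "len z = n" for z n
    using that
  proof (induction n arbitrary: z)
    case 0
    then have "z = \<one>" by (intro word_length_eq_0)
    then show ?case using \<open>B \<ge> 0\<close> by (simp add: green_dist_def)
  next
    case (Suc n)
    show ?case
    proof (cases "z \<in> ?E")
      case True
      have "0 \<le> e * real (Suc n)" using \<open>e > 0\<close> by simp
      then show ?thesis using B[OF True] by linarith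
    next
      case False
      obtain t y where t: "t \<in> T" and y: "y \<in> carrier G" "z = t \<otimes> y" "len y = n"
        using Suc.prems by (rule geodesic_step)
      have tG: "t \<in> carrier G" using t T_carrier by auto
      have "K t z = gr y / gr z"
        using tG y Suc.prems(1) by (simp add: K_eq m_assoc[symmetric])
      then have "\<bar>ln (gr y) - ln (gr z)\<bar> < e"
        using False t Suc.prems(1) gr_pos[OF y(1)] gr_pos[OF Suc.prems(1)] by (auto simp: ln_div)
      moreover have "\<bar>?d y\<bar> \<le> B + e * real n" using Suc.IH y by blast
      ultimately show ?thesis by (simp add: green_dist_def algebra_simps)
    qed
  qed
  then show ?thesis by blast
qed

text \<open>
  The three conclusions differ only in where the bound \<open>M\<close> on the ratio of length and time comes
  from: it is $1$ on a sphere, a bound for the convergent ratios along a path of finite speed, and a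
  bound holding with high probability.
\<close>

lemma green_dist_small:
  assumes K_lim: "\<And>x. x \<in> carrier G \<Longrightarrow> (K x \<longlongrightarrow> 1) at_inf" and "M > 0" "\<epsilon> > 0"
  shows "\<exists>N. \<forall>n\<ge>N. \<forall>z\<in>carrier G. real (len z) / real n \<le> M \<longrightarrow>
    \<bar>green_dist G \<mu> \<one> z / real n\<bar> < \<epsilon>"
proof -
  define e where "e = \<epsilon> / (2 * M)"
  have e: "e > 0" "e * M = \<epsilon> / 2" using assms(2,3) by (simp_all add: e_def)
  obtain B where B: "\<And>z. z \<in> carrier G \<Longrightarrow> \<bar>green_dist G \<mu> \<one> z\<bar> \<le> B + e * real (len z)"
    using green_dist_le[OF K_lim e(1)] by blast
  have "(\<lambda>n. B / real n) \<longlonglongrightarrow> 0" by (rule lim_const_over_n)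
  then have "\<forall>\<^sub>F n in sequentially. dist (B / real n) 0 < \<epsilon> / 2"
    using assms(3) by (intro tendstoD) simp_all
  then obtain N where N: "\<And>n. n \<ge> N \<Longrightarrow> \<bar>B / real n\<bar> < \<epsilon> / 2"
    by (auto simp: eventually_sequentially dist_real_def)
  have "\<bar>green_dist G \<mu> \<one> z / real n\<bar> < \<epsilon>"
    if "n \<ge> N" "z \<in> carrier G" "real (len z) / real n \<le> M" for n z
  proof -
    have "\<bar>green_dist G \<mu> \<one> z / real n\<bar> = \<bar>green_dist G \<mu> \<one> z\<bar> / real n" by simp
    also have "\<dots> \<le> (B + e * real (len z)) / real n"
      by (intro divide_right_mono B that(2)) simp
    also have "\<dots> = B / real n + e * (real (len z) / real n)" by (simp add: add_divide_distrib)
    also have "\<dots> \<le> B / real n + e * M" using e(1) that(3) by (intro add_left_mono mult_left_mono) auto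
    also have "\<dots> < \<epsilon>" using N[OF that(1)] e(2) by linarith
    finally show ?thesis .
  qed
  then show ?thesis by blast
qed

lemma green_dist_sphere_sublinear:
  assumes K_lim: "\<And>x. x \<in> carrier G \<Longrightarrow> (K x \<longlongrightarrow> 1) at_inf"
  shows "(\<lambda>r::nat. SUP x\<in>{x \<in> carrier G. len x = r}. green_dist G \<mu> \<one> x / real r) \<longlonglongrightarrow> 0"
proof (rule LIMSEQ_I)
  fix \<epsilon> :: real assume \<epsilon>: "\<epsilon> > 0"
  obtain N where N: "\<And>n z. n \<ge> N \<Longrightarrow> z \<in> carrier G \<Longrightarrow> real (len z) / real n \<le> 1 \<Longrightarrow>
      \<bar>green_dist G \<mu> \<one> z / real n\<bar> < \<epsilon> / 2"
    using green_dist_small[OF K_lim, of 1 "\<epsilon> / 2"] \<epsilon> by auto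
  have "\<bar>SUP x\<in>{x \<in> carrier G. len x = r}. green_dist G \<mu> \<one> x / real r\<bar> \<le> \<epsilon> / 2"
    if r: "r \<ge> N" for r
  proof (rule cSup_abs_le)
    show "(\<lambda>x. green_dist G \<mu> \<one> x / real r) ` {x \<in> carrier G. len x = r} \<noteq> {}"
      using sphere_nonempty[OF infinite, of r] by simp
    show "\<bar>a\<bar> \<le> \<epsilon> / 2" if "a \<in> (\<lambda>x. green_dist G \<mu> \<one> x / real r) ` {x \<in> carrier G. len x = r}" for a
      using that N[OF r] by (auto intro!: less_imp_le)
  qed
  then have "norm ((SUP x\<in>{x \<in> carrier G. len x = r}. green_dist G \<mu> \<one> x / real r) - 0) < \<epsilon>"
    if "r \<ge> N" for r
    using that \<epsilon> by (force intro: le_less_trans)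
  then show "\<exists>N. \<forall>r\<ge>N.
      norm ((SUP x\<in>{x \<in> carrier G. len x = r}. green_dist G \<mu> \<one> x / real r) - 0) < \<epsilon>"
    by blast
qed

lemma green_speed_zero:
  assumes K_lim: "\<And>x. x \<in> carrier G \<Longrightarrow> (K x \<longlongrightarrow> 1) at_inf"
    and \<omega>: "\<omega> \<in> space \<Omega>"
    and speed: "convergent (\<lambda>n. real (len (walk G \<omega> n)) / real n)"
  shows "(\<lambda>n. green_dist G \<mu> \<one> (walk G \<omega> n) / real n) \<longlonglongrightarrow> 0"
proof (rule LIMSEQ_I)
  fix \<epsilon> :: real assume \<epsilon>: "\<epsilon> > 0"
  obtain M where M: "M > 0" "\<And>n. norm (real (len (walk G \<omega> n)) / real n) \<le> M"
    using convergent_imp_Bseq[OF speed] unfolding Bseq_def by blast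
  have "real (len (walk G \<omega> n)) / real n \<le> M" for n using M(2)[of n] by simp
  then show "\<exists>N. \<forall>n\<ge>N. norm (green_dist G \<mu> \<one> (walk G \<omega> n) / real n - 0) < \<epsilon>"
    using green_dist_small[OF K_lim M(1) \<epsilon>] walk_closed[OF \<omega>]
    by (simp only: diff_0_right real_norm_def) blast
qed

lemma green_speed_zero_in_probability:
  assumes K_lim: "\<And>x. x \<in> carrier G \<Longrightarrow> (K x \<longlongrightarrow> 1) at_inf"
    and speed: "word_speed_finite_in_probability G T \<mu>" and \<epsilon>: "\<epsilon> > 0"
  shows "(\<lambda>n. path_prob G \<mu> (\<lambda>\<omega>. \<bar>green_dist G \<mu> \<one> (walk G \<omega> n) / real n\<bar> > \<epsilon>)) \<longlonglongrightarrow> 0"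
proof (rule LIMSEQ_I)
  fix \<delta> :: real assume "\<delta> > 0"
  then obtain M N1 where M: "M > 0" and N1: "\<And>n. n \<ge> N1 \<Longrightarrow>
      path_prob G \<mu> (\<lambda>\<omega>. real (len (walk G \<omega> n)) / real n > M) < \<delta>"
    using speed unfolding word_speed_finite_in_probability_def by blast
  obtain N2 where N2: "\<And>n z. n \<ge> N2 \<Longrightarrow> z \<in> carrier G \<Longrightarrow> real (len z) / real n \<le> M \<Longrightarrow>
      \<bar>green_dist G \<mu> \<one> z / real n\<bar> < \<epsilon>"
    using green_dist_small[OF K_lim M \<epsilon>] by blast
  have "norm (path_prob G \<mu> (\<lambda>\<omega>. \<bar>green_dist G \<mu> \<one> (walk G \<omega> n) / real n\<bar> > \<epsilon>) - 0) < \<delta>"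
    if n: "n \<ge> max N1 N2" for n
  proof -
    have "path_prob G \<mu> (\<lambda>\<omega>. \<bar>green_dist G \<mu> \<one> (walk G \<omega> n) / real n\<bar> > \<epsilon>) \<le>
        path_prob G \<mu> (\<lambda>\<omega>. real (len (walk G \<omega> n)) / real n > M)"
      unfolding path_prob_def
    proof (rule \<Omega>.finite_measure_mono[OF _ sets_walk], rule subsetI)
      fix \<omega> assume "\<omega> \<in> {\<omega> \<in> space \<Omega>. \<bar>green_dist G \<mu> \<one> (walk G \<omega> n) / real n\<bar> > \<epsilon>}"
      then show "\<omega> \<in> {\<omega> \<in> space \<Omega>. real (len (walk G \<omega> n)) / real n > M}"
        using N2[of n "walk G \<omega> n"] n walk_closed[of \<omega> n] by force
    qed
    also have "\<dots> < \<delta>" using N1 n by simp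
    finally show ?thesis by (simp add: path_prob_def)
  qed
  then show "\<exists>N. \<forall>n\<ge>N.
      norm (path_prob G \<mu> (\<lambda>\<omega>. \<bar>green_dist G \<mu> \<one> (walk G \<omega> n) / real n\<bar> > \<epsilon>) - 0) < \<delta>"
    by blast
qed

end
theorem theoremE:
  fixes G :: "('a, 'b) monoid_scheme" (structure)
    and T :: "'a set"
    and \<mu> :: "'a pmf"
    and C :: "'c topology" and j :: "'a \<Rightarrow> 'c"
  assumes "group G"
    and "infinite (carrier G)"
    and "symmetric_generating_set G T"
    and "set_pmf \<mu> \<subseteq> carrier G"
    and "symmetric_law G \<mu>"
    and "nondegenerate G \<mu>"
    and "transient G \<mu>"
  shows
    "(martin_compactification G \<mu> C j \<and> is_singleton (martin_boundary G C j) \<longrightarrow>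
        (\<lambda>r::nat. SUP x\<in>{x \<in> carrier G. word_length G T x = r}. green_dist G \<mu> \<one> x / real r)
          \<longlonglongrightarrow> 0 \<and>
        (\<forall>\<omega>\<in>space (path_space G \<mu>).
           convergent (\<lambda>n. real (word_length G T (walk G \<omega> n)) / real n) \<longrightarrow>
           (\<lambda>n. green_dist G \<mu> \<one> (walk G \<omega> n) / real n) \<longlonglongrightarrow> 0) \<and>
        (word_speed_finite_in_probability G T \<mu> \<longrightarrow>
           (\<forall>\<epsilon>>0. (\<lambda>n. path_prob G \<mu> (\<lambda>\<omega>. \<bar>green_dist G \<mu> \<one> (walk G \<omega> n) / real n\<bar> > \<epsilon>))
              \<longlonglongrightarrow> 0))) \<and>
     (strong_Liouville G \<mu> \<and> superexponential_moments G T \<mu> \<longrightarrow>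
        (\<lambda>r::nat. SUP x\<in>{x \<in> carrier G. word_length G T x = r}. green_dist G \<mu> \<one> x / real r)
          \<longlonglongrightarrow> 0 \<and>
        (\<forall>\<omega>\<in>space (path_space G \<mu>).
           convergent (\<lambda>n. real (word_length G T (walk G \<omega> n)) / real n) \<longrightarrow>
           (\<lambda>n. green_dist G \<mu> \<one> (walk G \<omega> n) / real n) \<longlonglongrightarrow> 0))"
proof -
  interpret transient_walk G T \<mu>
    using assms
    by (intro transient_walk.intro generated_group.intro group_law.intro
        generated_group_axioms.intro group_law_axioms.intro transient_walk_axioms.intro)
  show ?thesis
  proof (intro conjI impI)
    assume "martin_compactification G \<mu> C j \<and> is_singleton (martin_boundary G C j)"
    then have K_lim: "(K x \<longlongrightarrow> 1) at_inf" if "x \<in> carrier G" for x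
      using that kernel_tendsto_one_if_singleton_boundary
      unfolding martin_compactification_def by blast
    show "(\<lambda>r::nat. SUP x\<in>{x \<in> carrier G. len x = r}. green_dist G \<mu> \<one> x / real r) \<longlonglongrightarrow> 0"
      using K_lim by (rule green_dist_sphere_sublinear)
    show "\<forall>\<omega>\<in>space \<Omega>. convergent (\<lambda>n. real (len (walk G \<omega> n)) / real n) \<longrightarrow>
        (\<lambda>n. green_dist G \<mu> \<one> (walk G \<omega> n) / real n) \<longlonglongrightarrow> 0"
      using green_speed_zero[OF K_lim] by blast
    show "\<forall>\<epsilon>>0. (\<lambda>n. path_prob G \<mu> (\<lambda>\<omega>. \<bar>green_dist G \<mu> \<one> (walk G \<omega> n) / real n\<bar> > \<epsilon>)) \<longlonglongrightarrow> 0"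
      if "word_speed_finite_in_probability G T \<mu>"
      using green_speed_zero_in_probability[OF K_lim that] by blast
  next
    assume "strong_Liouville G \<mu> \<and> superexponential_moments G T \<mu>"
    then have K_lim: "(K x \<longlongrightarrow> 1) at_inf" if "x \<in> carrier G" for x
      using that kernel_tendsto_one_if_strong_Liouville by blast
    show "(\<lambda>r::nat. SUP x\<in>{x \<in> carrier G. len x = r}. green_dist G \<mu> \<one> x / real r) \<longlonglongrightarrow> 0"
      using K_lim by (rule green_dist_sphere_sublinear)
    show "\<forall>\<omega>\<in>space \<Omega>. convergent (\<lambda>n. real (len (walk G \<omega> n)) / real n) \<longrightarrow>
        (\<lambda>n. green_dist G \<mu> \<one> (walk G \<omega> n) / real n) \<longlonglongrightarrow> 0"
      using green_speed_zero[OF K_lim] by blast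
  qed
qed

end
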